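(* Let $d,n\geq 1$, let $x \in C_1([0,1], \mathbb{R}^d)$, let $I = (i_1,\ldots,i_n) \in \{1,\ldots,d\}^n$ be a multi-index, and let $z \in C_1([0,1],\mathbb{R}^n)$ be the axis path $z_t = (e_1 * e_2 * \cdots * e_n)_t$, $t \in [0,1]$, where $e_1,\ldots,e_n$ is the standard basis of $\mathbb{R}^n$, each $e_i$ is understood as the linear path from $\mathbf{0}$ to $e_i$, and $*$ denotes path concatenation. Then, with $\lambda = (\lambda_1,\ldots,\lambda_n)\in\mathbb{R}^n$, $$\frac{\partial^n}{\partial \lambda_1 \cdots \partial \lambda_n} \mathbf{k}_{x^I,\, \lambda \odot z} \Big|_{\lambda = 0} = S(x)^I.$$
   Context: $C_1([0,1],\mathbb{R}^k)$ is the space of continuous paths $[0,1]\to\mathbb{R}^k$ of finite 1-variation. For $x \in C_1([0,1],\mathbb{R}^k)$ with components $x = (x^{(1)},\ldots,x^{(k)})$ and a multi-index $J = (j_1,\ldots,j_m) \in \{1,\ldots,k\}^m$, the signature coefficient is the iterated Riemann--Stieltjes integral $S(x)^J = \int_{0<t_1<\cdots<t_m<1} dx^{(j_1)}_{t_1}\cdots dx^{(j_m)}_{t_m}$, with $S(x)^{\emptyset} = 1$ for the empty multi-index ($m=0$). For two paths $x,y$ of the same dimension $k$, the signature kernel is the (absolutely convergent) sum $\mathbf{k}_{x,y} = \langle S(x), S(y)\rangle = \sum_{m=0}^\infty \sum_{J \in \{1,\ldots,k\}^m} S(x)^J S(y)^J$. For $x \in C_1([0,1],\mathbb{R}^d)$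 and $I = (i_1,\ldots,i_n) \in \{1,\ldots,d\}^n$, $x^I \in C_1([0,1],\mathbb{R}^n)$ is the path with components $(x^{(i_1)},\ldots,x^{(i_n)})$. For $\lambda \in \mathbb{R}^n$ and an $n$-dimensional path $z$, $\lambda \odot z$ is the path with components $(\lambda_1 z^{(1)},\ldots,\lambda_n z^{(n)})$. The axis path $e_1 * \cdots * e_n$, parametrised on $[0,1]$, is the piecewise linear path starting at $\mathbf{0}$ that runs successively along the increments $e_1$, then $e_2$, ..., then $e_n$, attaining its $i$-th node $e_1+\cdots+e_i$ at time $t = i/n$ (the signature does not depend on the parametrisation). *)

theory Defs
  imports "HOL-Analysis.Analysis"
begin

text \<open>
  Paths on \<open>[0,1]\<close> are functions on the reals whose values outside the unit interval are
  never inspected.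
\<close>

definition finite_1_variation_on :: "real \<Rightarrow> real \<Rightarrow> (real \<Rightarrow> 'a::real_normed_vector) \<Rightarrow> bool"
  where "finite_1_variation_on a b x \<longleftrightarrow>
    bdd_above {\<Sum>K\<in>P. norm (x (Sup K) - x (Inf K)) | P. P division_of {a..b}}"

definition C1_path :: "(real \<Rightarrow> real^'k) \<Rightarrow> bool"
  where "C1_path x \<longleftrightarrow> continuous_on {0..1} x \<and> finite_1_variation_on 0 1 x"

text \<open>
  The gauge has constant radius \<open>\<delta>\<close>, so this is convergence of the Riemann--Stieltjes sums
  as the mesh of the tagged partition tends to zero, not a Henstock-type integral.
\<close>

definition has_RS_integral ::
    "(real \<Rightarrow> real) \<Rightarrow> (real \<Rightarrow> real) \<Rightarrow> real \<Rightarrow> real \<Rightarrow> real \<Rightarrow> bool"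
  where "has_RS_integral f g a b v \<longleftrightarrow>
    (\<forall>\<epsilon>>0. \<exists>\<delta>>0. \<forall>P. P tagged_division_of {a..b} \<and> (\<lambda>s. ball s \<delta>) fine P \<longrightarrow>
      \<bar>(\<Sum>(s, K)\<in>P. f s * (g (Sup K) - g (Inf K))) - v\<bar> < \<epsilon>)"

definition RS_integral :: "(real \<Rightarrow> real) \<Rightarrow> (real \<Rightarrow> real) \<Rightarrow> real \<Rightarrow> real \<Rightarrow> real"
  where "RS_integral f g a b = (THE v. has_RS_integral f g a b v)"

text \<open>
  \<open>rev_signature x [j\<^sub>m, \<dots>, j\<^sub>1] t\<close> is the integral of
  \<open>dx(j\<^sub>1) \<dots> dx(j\<^sub>m)\<close> over \<open>0 < t\<^sub>1 < \<dots> < t\<^sub>m < t\<close>; the head of the list is the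
  outermost (last) integration variable.
\<close>

primrec rev_signature :: "(real \<Rightarrow> real^'k) \<Rightarrow> 'k list \<Rightarrow> real \<Rightarrow> real"
  where
    "rev_signature x [] = (\<lambda>t. 1)"
  | "rev_signature x (j # J) = (\<lambda>t. RS_integral (rev_signature x J) (\<lambda>s. x s $ j) 0 t)"

definition signature :: "(real \<Rightarrow> real^'k) \<Rightarrow> 'k list \<Rightarrow> real"
  where "signature x J = rev_signature x (rev J) 1"

definition signature_kernel :: "(real \<Rightarrow> real^'k) \<Rightarrow> (real \<Rightarrow> real^'k) \<Rightarrow> real"
  where "signature_kernel x y =
    (\<Sum>m. \<Sum>J | length J = m. signature x J * signature y J)"

text \<open>
  The index set \<open>{1,\<dots>,n}\<close> is rendered as a finite linearly ordered type \<open>'n\<close>, listed here in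
  increasing order; a multi-index in \<open>{1,\<dots>,d}\<^sup>n\<close> is a function from \<open>'n\<close> to \<open>'d\<close>.
\<close>

definition index_list :: "'n::{finite,linorder} list"
  where "index_list = sorted_list_of_set UNIV"

definition select_path :: "('n \<Rightarrow> 'd) \<Rightarrow> (real \<Rightarrow> real^'d) \<Rightarrow> real \<Rightarrow> real^'n"
  where "select_path I x t = (\<chi> j. x t $ I j)"

definition scale_path :: "real^'n \<Rightarrow> (real \<Rightarrow> real^'n) \<Rightarrow> real \<Rightarrow> real^'n"
  where "scale_path l z t = (\<chi> j. l $ j * z t $ j)"

text \<open>
  The concatenation \<open>v\<^sub>1 * \<dots> * v\<^sub>n\<close> of linear paths with the given increments, started at 0
  and traversing each increment in time \<open>1/n\<close>.  At \<open>t = 1\<close> the out-of-range entry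
  \<open>vs ! n\<close> is multiplied by 0.
\<close>

definition concat_linear :: "'a::real_vector list \<Rightarrow> real \<Rightarrow> 'a"
  where "concat_linear vs t =
    (let n = length vs; i = nat \<lfloor>real n * t\<rfloor>
     in sum_list (take i vs) + (real n * t - real i) *\<^sub>R (vs ! i))"

definition axis_path :: "real \<Rightarrow> real^'n::{finite,linorder}"
  where "axis_path = concat_linear (map (\<lambda>i. axis i 1) index_list)"

text \<open>
  \<open>has_mixed_partial [j\<^sub>1, \<dots>, j\<^sub>m] f D p\<close>: the iterated derivative
  \<open>\<partial>\<^sub>j\<^sub>1 (\<partial>\<^sub>j\<^sub>2 (\<dots> \<partial>\<^sub>j\<^sub>m f))\<close> exists at \<open>p\<close> and equals \<open>D\<close>; the inner derivatives, whose
  values are collected in \<open>g\<close>, are required to exist near \<open>p\<close>.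
\<close>

primrec has_mixed_partial ::
    "'n list \<Rightarrow> (real^'n \<Rightarrow> real) \<Rightarrow> real \<Rightarrow> real^'n \<Rightarrow> bool"
  where
    "has_mixed_partial [] f D p \<longleftrightarrow> f p = D"
  | "has_mixed_partial (j # js) f D p \<longleftrightarrow>
      (\<exists>g. (\<forall>\<^sub>F q in nhds p. has_mixed_partial js f (g q) q) \<and>
           ((\<lambda>h. g (p + h *\<^sub>R axis j 1)) has_real_derivative D) (at 0))"

end

theory Submission
  imports Defs
begin

text \<open>
  By multilinearity the kernel is the power series
  \<open>\<Sum>\<^sub>J S(x\<^sup>I)\<^sup>J S(z)\<^sup>J \<lambda>\<^sup>J\<close> in \<open>\<lambda>\<close>, whose coefficients grow at most geometrically in the
  length of \<open>J\<close>; so it may be differentiated term by term near 0.  At 0 the mixed partial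
  derivative picks out the words \<open>J\<close> in which every letter occurs exactly once, and for such a
  word \<open>S(z)\<^sup>J\<close> is 1 if \<open>J\<close> is increasing and 0 otherwise, because the axis path moves one
  coordinate after the other.
\<close>

section \<open>Riemann--Stieltjes integrals\<close>

text \<open>\<open>RS_integral\<close> is a definite description, so nothing can be said about
  \<open>rev_signature\<close> before every iterated integral is known to exist as a mesh limit.
  Existence is obtained not by comparing Riemann sums but by constructing an indefinite integral,
  whose increments match \<open>f s * (g d - g c)\<close> up to a small multiple of the increment of
  a fixed \<open>w\<close>. Such an indefinite integral is continuous, hence an admissible integrand
  for the next level of iteration. The same \<open>w\<close> bounds the coefficients. The factor
  1/m! coming from the volume of the simplex is given up: the bound is only geometric, and the
  series is controlled only in a small box around 0, which is all that a derivative at 0 needs. The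
  box must not shrink from one partial derivative to the next. Each coordinate is differentiated
  only once, so a spare factor 2 in the radius, fixed in advance, absorbs all the exponents that
  differentiation produces.\<close>

definition control :: "real \<Rightarrow> real \<Rightarrow> (real \<Rightarrow> real) \<Rightarrow> (real \<Rightarrow> real) \<Rightarrow> bool"
  where "control a b w g \<longleftrightarrow> (\<forall>c d. a \<le> c \<longrightarrow> c \<le> d \<longrightarrow> d \<le> b \<longrightarrow> \<bar>g d - g c\<bar> \<le> w d - w c)"

lemma controlD: "control a b w g \<Longrightarrow> a \<le> c \<Longrightarrow> c \<le> d \<Longrightarrow> d \<le> b \<Longrightarrow> \<bar>g d - g c\<bar> \<le> w d - w c"
  by (simp add: control_def)

lemma control_subinterval:
  "control a b w g \<Longrightarrow> a \<le> c \<Longrightarrow> d \<le> b \<Longrightarrow> control c d w g"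
  by (simp add: control_def)

lemma control_nonneg: "control a b w g \<Longrightarrow> a \<le> c \<Longrightarrow> c \<le> d \<Longrightarrow> d \<le> b \<Longrightarrow> 0 \<le> w d - w c"
  using controlD[of a b w g c d] by linarith

text \<open>
  A sewing-type characterisation of the indefinite integral \<open>\<Phi>\<close> of \<open>f\<close> against \<open>g\<close>: summing the
  local estimate over a tagged division gives an error of at most \<open>\<epsilon> * (w b - w a)\<close>, and additivity
  in the interval is built in, so common refinements of divisions are never needed.
\<close>

definition RS_primitive ::
    "(real \<Rightarrow> real) \<Rightarrow> (real \<Rightarrow> real) \<Rightarrow> (real \<Rightarrow> real) \<Rightarrow> real \<Rightarrow> real \<Rightarrow> (real \<Rightarrow> real) \<Rightarrow> bool"
  where "RS_primitive f g w a b \<Phi> \<longleftrightarrow>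
    (\<forall>\<epsilon>>0. \<exists>\<delta>>0. \<forall>c s d. a \<le> c \<longrightarrow> c \<le> s \<longrightarrow> s \<le> d \<longrightarrow> d \<le> b \<longrightarrow> d - c < \<delta> \<longrightarrow>
      \<bar>\<Phi> d - \<Phi> c - f s * (g d - g c)\<bar> \<le> \<epsilon> * (w d - w c))"

lemma tagged_division_of_real_interval:
  fixes a b :: real
  assumes "P tagged_division_of {a..b}" "(s, K) \<in> P"
  obtains c d where "K = {c..d}" "a \<le> c" "c \<le> s" "s \<le> d" "d \<le> b" "Inf K = c" "Sup K = d"
proof -
  obtain c d where K: "K = {c..d}" using tagged_division_ofD(4)[OF assms] by auto
  have "s \<in> K" "K \<subseteq> {a..b}" using tagged_division_ofD(2,3)[OF assms] by auto
  then show ?thesis using K by (intro that[of c d]) auto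
qed

lemma RS_primitiveE:
  assumes "RS_primitive f g w a b \<Phi>" "\<epsilon> > 0"
  obtains \<delta> where "\<delta> > 0" "\<And>c s d. a \<le> c \<Longrightarrow> c \<le> s \<Longrightarrow> s \<le> d \<Longrightarrow> d \<le> b \<Longrightarrow> d - c < \<delta> \<Longrightarrow>
      \<bar>\<Phi> d - \<Phi> c - f s * (g d - g c)\<bar> \<le> \<epsilon> * (w d - w c)"
proof -
  obtain \<delta> where \<delta>: "\<delta> > 0 \<and> (\<forall>c s d. a \<le> c \<longrightarrow> c \<le> s \<longrightarrow> s \<le> d \<longrightarrow> d \<le> b \<longrightarrow> d - c < \<delta> \<longrightarrow>
      \<bar>\<Phi> d - \<Phi> c - f s * (g d - g c)\<bar> \<le> \<epsilon> * (w d - w c))"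
    by (rule exE[OF assms(1)[unfolded RS_primitive_def, THEN spec, THEN mp, OF assms(2)]])
  show ?thesis
    by (rule that[of \<delta>]) (use \<delta> in auto)
qed

text \<open>\<open>h s c d\<close> stands for any local quantity attached to a tagged interval. Its
  bounds by increments of \<open>w\<close> telescope, so the total is independent of how fine the
  division is.\<close>

lemma RS_sum_bound:
  fixes a b :: real
  assumes "a \<le> b" and P: "P tagged_division_of {a..b}"
    and w: "\<And>s c d. (s, {c..d}) \<in> P \<Longrightarrow> a \<le> c \<Longrightarrow> c \<le> s \<Longrightarrow> s \<le> d \<Longrightarrow> d \<le> b \<Longrightarrow>
      \<bar>h s c d\<bar> \<le> M * (w d - w c)"
  shows "\<bar>\<Sum>(s, K)\<in>P. h s (Inf K) (Sup K)\<bar> \<le> M * (w b - w a :: real)"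
proof -
  have "\<bar>\<Sum>(s, K)\<in>P. h s (Inf K) (Sup K)\<bar> \<le> (\<Sum>z\<in>P. \<bar>case z of (s, K) \<Rightarrow> h s (Inf K) (Sup K)\<bar>)"
    by (rule sum_abs)
  also have "\<dots> \<le> (\<Sum>z\<in>P. M * (case z of (s, K) \<Rightarrow> w (Sup K) - w (Inf K)))"
  proof (rule sum_mono)
    fix z assume z: "z \<in> P"
    obtain s K where [simp]: "z = (s, K)" by fastforce
    from z have "(s, K) \<in> P" by simp
    then obtain c d where "K = {c..d}" "a \<le> c" "c \<le> s" "s \<le> d"
      "d \<le> b" "Inf K = c" "Sup K = d" by (rule tagged_division_of_real_interval[OF P])
    then show "\<bar>case z of (s, K) \<Rightarrow> h s (Inf K) (Sup K)\<bar> \<le> M * (case z of (s, K) \<Rightarrow> w (Sup K) - w (Inf K))"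
      using w[of s c d] z by simp
  qed
  also have "\<dots> = M * (w b - w a)"
    using additive_tagged_division_1[OF \<open>a \<le> b\<close> P, of w] by (simp add: sum_distrib_left[symmetric])
  finally show ?thesis .
qed

lemma fine_ball_mono: "(\<lambda>s. ball s \<delta>) fine P \<Longrightarrow> \<delta> \<le> \<delta>' \<Longrightarrow> (\<lambda>s. ball s \<delta>') fine P"
  unfolding fine_def using subset_ball by fast

lemma has_RS_integralE:
  assumes "has_RS_integral f g a b v" "\<epsilon> > 0"
  obtains \<delta> where "\<delta> > 0" "\<And>P. P tagged_division_of {a..b} \<Longrightarrow> (\<lambda>s. ball s \<delta>) fine P \<Longrightarrow>
      \<bar>(\<Sum>(s, K)\<in>P. f s * (g (Sup K) - g (Inf K))) - v\<bar> < \<epsilon>"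
proof -
  obtain \<delta> where \<delta>: "\<delta> > 0 \<and> (\<forall>P. P tagged_division_of {a..b} \<and> (\<lambda>s. ball s \<delta>) fine P \<longrightarrow>
      \<bar>(\<Sum>(s, K)\<in>P. f s * (g (Sup K) - g (Inf K))) - v\<bar> < \<epsilon>)"
    by (rule exE[OF assms(1)[unfolded has_RS_integral_def, THEN spec, THEN mp, OF assms(2)]])
  show ?thesis
  proof (rule that[of \<delta>])
    fix P assume "P tagged_division_of {a..b}" "(\<lambda>s. ball s \<delta>) fine P"
    then show "\<bar>(\<Sum>(s, K)\<in>P. f s * (g (Sup K) - g (Inf K))) - v\<bar> < \<epsilon>"
      by (intro \<delta>[THEN conjunct2, THEN spec, THEN mp] conjI)
  qed (use \<delta> in simp)
qed

text \<open>The increments of \<open>\<Phi>\<close> telescope exactly, so a Riemann--Stieltjes sum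
  differs from \<open>\<Phi> d - \<Phi> c\<close> only by the accumulated local errors.\<close>

lemma has_RS_integral_of_primitive:
  assumes \<Phi>: "RS_primitive f g w a b \<Phi>" and ctl: "control a b w g" and cd: "a \<le> c" "c \<le> d" "d \<le> b"
  shows "has_RS_integral f g c d (\<Phi> d - \<Phi> c)"
  unfolding has_RS_integral_def
proof (intro allI impI)
  fix \<epsilon> :: real assume "\<epsilon> > 0"
  \<comment> \<open>The \<open>+ 1\<close> keeps the denominator positive when
    \<open>w d = w c\<close> and makes the final bound strict.\<close>
  define \<eta> where "\<eta> = \<epsilon> / (w d - w c + 1)"
  have nn: "0 \<le> w d - w c" using control_nonneg[OF ctl] cd by auto
  then have "\<eta> > 0" using \<open>\<epsilon> > 0\<close> by (simp add: \<eta>_def)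
  then obtain \<delta> where "\<delta> > 0" and \<delta>: "\<And>c s d. a \<le> c \<Longrightarrow> c \<le> s \<Longrightarrow> s \<le> d \<Longrightarrow> d \<le> b \<Longrightarrow> d - c < \<delta> \<Longrightarrow>
      \<bar>\<Phi> d - \<Phi> c - f s * (g d - g c)\<bar> \<le> \<eta> * (w d - w c)"
    by (rule RS_primitiveE[OF \<Phi>]) blast
  have lt: "\<eta> * (w d - w c) < \<epsilon>"
    using nn \<open>\<epsilon> > 0\<close> by (simp add: \<eta>_def field_simps)
  show "\<exists>\<delta>>0. \<forall>P. P tagged_division_of {c..d} \<and> (\<lambda>s. ball s \<delta>) fine P \<longrightarrow>
      \<bar>(\<Sum>(s, K)\<in>P. f s * (g (Sup K) - g (Inf K))) - (\<Phi> d - \<Phi> c)\<bar> < \<epsilon>"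
  \<comment> \<open>Both ends of an interval lie within half of \<open>\<delta>\<close> of its tag,
    so its length is below \<open>\<delta>\<close>.\<close>
  proof (intro exI[of _ "\<delta> / 2"] conjI allI impI)
    fix P assume "P tagged_division_of {c..d} \<and> (\<lambda>s. ball s (\<delta> / 2)) fine P"
    then have P: "P tagged_division_of {c..d}" and fine: "(\<lambda>s. ball s (\<delta> / 2)) fine P" by auto
    have "\<bar>\<Sum>(s, K)\<in>P. \<Phi> (Sup K) - \<Phi> (Inf K) - f s * (g (Sup K) - g (Inf K))\<bar> \<le> \<eta> * (w d - w c)"
    proof (rule RS_sum_bound[OF cd(2) P])
      fix s u v assume *: "(s, {u..v}) \<in> P" "c \<le> u" "u \<le> s" "s \<le> v" "v \<le> d"
      then have "{u..v} \<subseteq> ball s (\<delta> / 2)" using fine by (auto simp: fine_def)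
      then have "dist s u < \<delta> / 2" "dist s v < \<delta> / 2" using * by (auto simp: subset_iff)
      then have "v - u < \<delta>" unfolding dist_real_def by linarith
      with * cd show "\<bar>\<Phi> v - \<Phi> u - f s * (g v - g u)\<bar> \<le> \<eta> * (w v - w u)"
        by (intro \<delta>) auto
    qed
    moreover have "(\<Sum>(s, K)\<in>P. \<Phi> (Sup K) - \<Phi> (Inf K) - f s * (g (Sup K) - g (Inf K)))
        = (\<Phi> d - \<Phi> c) - (\<Sum>(s, K)\<in>P. f s * (g (Sup K) - g (Inf K)))"
      using additive_tagged_division_1[OF cd(2) P, of \<Phi>]
      by (simp add: case_prod_unfold sum_subtractf)
    ultimately show "\<bar>(\<Sum>(s, K)\<in>P. f s * (g (Sup K) - g (Inf K))) - (\<Phi> d - \<Phi> c)\<bar> < \<epsilon>"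
      using lt by linarith
  qed (use \<open>\<delta> > 0\<close> in auto)
qed

section \<open>Linearity, size and uniqueness of the integral\<close>

lemma has_RS_integral_cong:
  assumes "\<And>s. s \<in> {a..b} \<Longrightarrow> f s = f' s" "\<And>s. s \<in> {a..b} \<Longrightarrow> g s = g' s"
  shows "has_RS_integral f g a b v \<longleftrightarrow> has_RS_integral f' g' a b v"
proof -
  have "(\<Sum>(s, K)\<in>P. f s * (g (Sup K) - g (Inf K))) = (\<Sum>(s, K)\<in>P. f' s * (g' (Sup K) - g' (Inf K)))"
    if P: "P tagged_division_of {a..b}" for P
  proof (rule sum.cong[OF refl])
    fix z assume z: "z \<in> P"
    obtain s K where [simp]: "z = (s, K)" by fastforce
    from z have "(s, K) \<in> P" by simp
    then obtain c d where "a \<le> c" "c \<le> s" "s \<le> d"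
      "d \<le> b" "Inf K = c" "Sup K = d" by (rule tagged_division_of_real_interval[OF P])
    then show "(case z of (s, K) \<Rightarrow> f s * (g (Sup K) - g (Inf K)))
        = (case z of (s, K) \<Rightarrow> f' s * (g' (Sup K) - g' (Inf K)))"
      by (simp add: assms)
  qed
  then show ?thesis unfolding has_RS_integral_def by (simp cong: conj_cong imp_cong)
qed

lemma has_RS_integral_diff:
  assumes "has_RS_integral f g a b u" "has_RS_integral f' g a b v"
  shows "has_RS_integral (\<lambda>s. f s - f' s) g a b (u - v)"
  unfolding has_RS_integral_def
proof (intro allI impI)
  fix \<epsilon> :: real assume "\<epsilon> > 0"
  then have "\<epsilon> / 2 > 0" by simp
  note e = this
  obtain \<delta>1 where d1: "\<delta>1 > 0" and 1: "\<And>P. P tagged_division_of {a..b} \<Longrightarrow> (\<lambda>s. ball s \<delta>1) fine P \<Longrightarrow>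
      \<bar>(\<Sum>(s, K)\<in>P. f s * (g (Sup K) - g (Inf K))) - u\<bar> < \<epsilon> / 2"
    by (rule has_RS_integralE[OF assms(1) e]) blast
  obtain \<delta>2 where d2: "\<delta>2 > 0" and 2: "\<And>P. P tagged_division_of {a..b} \<Longrightarrow> (\<lambda>s. ball s \<delta>2) fine P \<Longrightarrow>
      \<bar>(\<Sum>(s, K)\<in>P. f' s * (g (Sup K) - g (Inf K))) - v\<bar> < \<epsilon> / 2"
    by (rule has_RS_integralE[OF assms(2) e]) blast
  note d = d1 d2
  show "\<exists>\<delta>>0. \<forall>P. P tagged_division_of {a..b} \<and> (\<lambda>s. ball s \<delta>) fine P \<longrightarrow>
      \<bar>(\<Sum>(s, K)\<in>P. (f s - f' s) * (g (Sup K) - g (Inf K))) - (u - v)\<bar> < \<epsilon>"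
  proof (intro exI[of _ "min \<delta>1 \<delta>2"] conjI allI impI)
    fix P assume P: "P tagged_division_of {a..b} \<and> (\<lambda>s. ball s (min \<delta>1 \<delta>2)) fine P"
    then have "(\<lambda>s. ball s \<delta>1) fine P" "(\<lambda>s. ball s \<delta>2) fine P"
      by (auto elim: fine_ball_mono)
    with 1[of P] 2[of P] P
    have "\<bar>(\<Sum>(s, K)\<in>P. f s * (g (Sup K) - g (Inf K))) - u\<bar> < \<epsilon> / 2"
      "\<bar>(\<Sum>(s, K)\<in>P. f' s * (g (Sup K) - g (Inf K))) - v\<bar> < \<epsilon> / 2" by auto
    moreover have "(\<Sum>(s, K)\<in>P. (f s - f' s) * (g (Sup K) - g (Inf K)))
        = (\<Sum>(s, K)\<in>P. f s * (g (Sup K) - g (Inf K))) - (\<Sum>(s, K)\<in>P. f' s * (g (Sup K) - g (Inf K)))"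
      by (simp add: case_prod_unfold left_diff_distrib sum_subtractf)
    ultimately show "\<bar>(\<Sum>(s, K)\<in>P. (f s - f' s) * (g (Sup K) - g (Inf K))) - (u - v)\<bar> < \<epsilon>"
      by linarith
  qed (use d in auto)
qed

text \<open>For a rescaled path the inner iterated integral and the integrator each carry a factor,
  hence the two scalars.\<close>

lemma has_RS_integral_cmult:
  assumes "has_RS_integral f g a b v"
  shows "has_RS_integral (\<lambda>s. k * f s) (\<lambda>s. l * g s) a b (k * l * v)"
  unfolding has_RS_integral_def
proof (intro allI impI)
  fix \<epsilon> :: real assume "\<epsilon> > 0"
  then have e: "\<epsilon> / (\<bar>k * l\<bar> + 1) > 0" by simp
  obtain \<delta> where d: "\<delta> > 0"
    and 1: "\<And>P. P tagged_division_of {a..b} \<Longrightarrow> (\<lambda>s. ball s \<delta>) fine P \<Longrightarrow>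
      \<bar>(\<Sum>(s, K)\<in>P. f s * (g (Sup K) - g (Inf K))) - v\<bar> < \<epsilon> / (\<bar>k * l\<bar> + 1)"
    by (rule has_RS_integralE[OF assms e]) blast
  show "\<exists>\<delta>>0. \<forall>P. P tagged_division_of {a..b} \<and> (\<lambda>s. ball s \<delta>) fine P \<longrightarrow>
      \<bar>(\<Sum>(s, K)\<in>P. k * f s * (l * g (Sup K) - l * g (Inf K))) - k * l * v\<bar> < \<epsilon>"
  proof (intro exI[of _ \<delta>] conjI allI impI)
    fix P assume P: "P tagged_division_of {a..b} \<and> (\<lambda>s. ball s \<delta>) fine P"
    let ?S = "\<Sum>(s, K)\<in>P. f s * (g (Sup K) - g (Inf K))"
    have "(\<Sum>(s, K)\<in>P. k * f s * (l * g (Sup K) - l * g (Inf K))) - k * l * v = k * l * (?S - v)"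
      by (simp add: case_prod_unfold right_diff_distrib sum_distrib_left algebra_simps sum_subtractf)
    also have "\<bar>\<dots>\<bar> \<le> (\<bar>k * l\<bar> + 1) * \<bar>?S - v\<bar>"
      unfolding abs_mult[of "k * l"] by (intro mult_right_mono) auto
    also have "\<dots> < \<epsilon>"
      using 1[of P] P by (simp add: field_simps)
    finally show "\<bar>(\<Sum>(s, K)\<in>P. k * f s * (l * g (Sup K) - l * g (Inf K))) - k * l * v\<bar> < \<epsilon>" .
  qed (use d in auto)
qed

lemma has_RS_integral_bound:
  assumes v: "has_RS_integral f g a b v" and ab: "a \<le> b" and ctl: "control a b w g"
    and M: "\<And>s. s \<in> {a..b} \<Longrightarrow> \<bar>f s\<bar> \<le> M"
  shows "\<bar>v\<bar> \<le> M * (w b - w a)"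
proof (rule field_le_epsilon)
  fix \<epsilon> :: real assume "\<epsilon> > 0"
  then obtain \<delta> where d: "\<delta> > 0"
    and 1: "\<And>P. P tagged_division_of {a..b} \<Longrightarrow> (\<lambda>s. ball s \<delta>) fine P \<Longrightarrow>
      \<bar>(\<Sum>(s, K)\<in>P. f s * (g (Sup K) - g (Inf K))) - v\<bar> < \<epsilon>"
    by (rule has_RS_integralE[OF v]) blast
  obtain P where P: "P tagged_division_of {a..b}" "(\<lambda>s. ball s \<delta>) fine P"
    using fine_division_exists_real[of "\<lambda>s. ball s \<delta>" a b] d by (auto simp: gauge_def)
  have "\<bar>\<Sum>(s, K)\<in>P. f s * (g (Sup K) - g (Inf K))\<bar> \<le> M * (w b - w a)"
  proof (rule RS_sum_bound[OF ab P(1)])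
    fix s c d assume *: "a \<le> c" "c \<le> s" "s \<le> d" "d \<le> b"
    show "\<bar>f s * (g d - g c)\<bar> \<le> M * (w d - w c)"
      unfolding abs_mult using * M[of s] controlD[OF ctl, of c d] by (intro mult_mono) auto
  qed
  with 1[OF P] show "\<bar>v\<bar> \<le> M * (w b - w a) + \<epsilon>" by linarith
qed

text \<open>Two candidate limits are compared on one division fine for both meshes. Such divisions
  exist for every positive radius, so the defining condition is never vacuous.\<close>

lemma has_RS_integral_unique:
  assumes "has_RS_integral f g a b u" "has_RS_integral f g a b v"
  shows "u = v"
proof (rule ccontr)
  assume "u \<noteq> v"
  then have "\<bar>u - v\<bar> / 2 > 0" by simp
  note e = this
  obtain \<delta>1 where d1: "\<delta>1 > 0" and 1: "\<And>P. P tagged_division_of {a..b} \<Longrightarrow> (\<lambda>s. ball s \<delta>1) fine P \<Longrightarrow>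
      \<bar>(\<Sum>(s, K)\<in>P. f s * (g (Sup K) - g (Inf K))) - u\<bar> < \<bar>u - v\<bar> / 2"
    by (rule has_RS_integralE[OF assms(1) e]) blast
  obtain \<delta>2 where d2: "\<delta>2 > 0" and 2: "\<And>P. P tagged_division_of {a..b} \<Longrightarrow> (\<lambda>s. ball s \<delta>2) fine P \<Longrightarrow>
      \<bar>(\<Sum>(s, K)\<in>P. f s * (g (Sup K) - g (Inf K))) - v\<bar> < \<bar>u - v\<bar> / 2"
    by (rule has_RS_integralE[OF assms(2) e]) blast
  note d = d1 d2
  obtain P where P: "P tagged_division_of {a..b}" "(\<lambda>s. ball s (min \<delta>1 \<delta>2)) fine P"
    using fine_division_exists_real[of "\<lambda>s. ball s (min \<delta>1 \<delta>2)" a b] d by (auto simp: gauge_def)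
  then have "(\<lambda>s. ball s \<delta>1) fine P" "(\<lambda>s. ball s \<delta>2) fine P"
    by (auto elim: fine_ball_mono)
  with 1[of P] 2[of P] P show False by (auto simp: abs_if split: if_splits)
qed

lemma RS_integral_eqI: "has_RS_integral f g a b v \<Longrightarrow> RS_integral f g a b = v"
  unfolding RS_integral_def using has_RS_integral_unique by blast

text \<open>Integration by parts reduces smooth integrands to ordinary integrals.  The control must also
  dominate the identity, to absorb the error \<open>\<integral>\<^sub>c\<^sup>d (g u - g c) f' u du\<close>.\<close>

lemma RS_primitive_smooth:
  assumes f: "\<And>t. t \<in> {a..b} \<Longrightarrow> (f has_real_derivative f' t) (at t)"
    and f': "continuous_on {a..b} f'" and g: "continuous_on {a..b} g"
    and ctl: "control a b w g" and w_id: "control a b w (\<lambda>t. t)"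
  shows "RS_primitive f g w a b (\<lambda>t. f t * g t - integral {a..t} (\<lambda>u. g u * f' u))"
  unfolding RS_primitive_def
proof (intro allI impI)
  fix \<epsilon> :: real assume "\<epsilon> > 0"
  have cf: "continuous_on {a..b} f"
    using f by (meson DERIV_isCont continuous_at_imp_continuous_on)
  have "bounded (f' ` {a..b})"
    using f' by (intro compact_imp_bounded compact_continuous_image) auto
  then obtain M where "M > 0" and M: "\<And>t. t \<in> {a..b} \<Longrightarrow> \<bar>f' t\<bar> \<le> M"
    unfolding bounded_pos by auto
  \<comment> \<open>Half of the error goes to the oscillation of \<open>f\<close> against the
    increment of \<open>g\<close>, half to the oscillation of \<open>g\<close> against
    \<open>f'\<close>, which is bounded by \<open>M\<close>.\<close>
  have "\<epsilon> / 2 > 0" "\<epsilon> / (2 * M) > 0" using \<open>\<epsilon> > 0\<close> \<open>M > 0\<close> by auto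
  moreover have "uniformly_continuous_on {a..b} f" "uniformly_continuous_on {a..b} g"
    using cf g by (auto intro: compact_uniformly_continuous)
  ultimately obtain \<delta>1 \<delta>2 where d: "\<delta>1 > 0" "\<delta>2 > 0"
    and 1: "\<And>s t. s \<in> {a..b} \<Longrightarrow> t \<in> {a..b} \<Longrightarrow> \<bar>t - s\<bar> < \<delta>1 \<Longrightarrow> \<bar>f t - f s\<bar> < \<epsilon> / 2"
    and 2: "\<And>s t. s \<in> {a..b} \<Longrightarrow> t \<in> {a..b} \<Longrightarrow> \<bar>t - s\<bar> < \<delta>2 \<Longrightarrow> \<bar>g t - g s\<bar> < \<epsilon> / (2 * M)"
    unfolding uniformly_continuous_on_def dist_real_def by metis
  show "\<exists>\<delta>>0. \<forall>c s d. a \<le> c \<longrightarrow> c \<le> s \<longrightarrow> s \<le> d \<longrightarrow> d \<le> b \<longrightarrow> d - c < \<delta> \<longrightarrow>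
      \<bar>(f d * g d - integral {a..d} (\<lambda>u. g u * f' u)) - (f c * g c - integral {a..c} (\<lambda>u. g u * f' u))
        - f s * (g d - g c)\<bar> \<le> \<epsilon> * (w d - w c)"
  proof (intro exI[of _ "min \<delta>1 \<delta>2"] conjI allI impI)
    fix c s d assume *: "a \<le> c" "c \<le> s" "s \<le> d" "d \<le> b" "d - c < min \<delta>1 \<delta>2"
    have sub: "{c..d} \<subseteq> {a..b}" "{a..d} \<subseteq> {a..b}" using * by auto
    have cont: "continuous_on {c..d} (\<lambda>u. (g u - g c) * f' u)" "continuous_on {c..d} (\<lambda>u. g u * f' u)"
      "continuous_on {a..d} (\<lambda>u. g u * f' u)"
      using sub f' g by (auto intro!: continuous_intros intro: continuous_on_subset)
    have ftc: "(f' has_integral (f d - f c)) {c..d}"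
      using * f by (intro fundamental_theorem_of_calculus)
        (auto simp: has_real_derivative_iff_has_vector_derivative[symmetric] intro: has_field_derivative_at_within)
    \<comment> \<open>Subtracting the constant \<open>g c\<close> costs
      \<open>g c * (f d - f c)\<close>, which the boundary terms absorb. The remaining integrand is
      small because \<open>g\<close> oscillates little on a short interval.\<close>
    have "integral {c..d} (\<lambda>u. (g u - g c) * f' u) = integral {c..d} (\<lambda>u. g u * f' u - g c * f' u)"
      by (simp add: left_diff_distrib)
    also have "\<dots> = integral {c..d} (\<lambda>u. g u * f' u) - g c * (f d - f c)"
      using ftc cont(2) by (intro integral_unique has_integral_diff has_integral_mult_right)
        (auto intro: integrable_integral integrable_continuous_real)
    also have "integral {c..d} (\<lambda>u. g u * f' u)
        = integral {a..d} (\<lambda>u. g u * f' u) - integral {a..c} (\<lambda>u. g u * f' u)"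
      using Henstock_Kurzweil_Integration.integral_combine[where a = a and b = d and c = c and f = "\<lambda>u. g u * f' u"] * integrable_continuous_real[OF cont(3)]
      by simp
    finally have eq: "(f d * g d - integral {a..d} (\<lambda>u. g u * f' u)) - (f c * g c - integral {a..c} (\<lambda>u. g u * f' u))
        - f s * (g d - g c) = (f d - f s) * (g d - g c) - integral {c..d} (\<lambda>u. (g u - g c) * f' u)"
      by (simp add: algebra_simps)
    have "norm (integral {c..d} (\<lambda>u. (g u - g c) * f' u)) \<le> \<epsilon> / 2 * (d - c)"
    proof (rule integral_bound[OF _ cont(1)])
      fix u assume "u \<in> {c..d}"
      then have "\<bar>g u - g c\<bar> * \<bar>f' u\<bar> \<le> \<epsilon> / (2 * M) * M"
        using * 2[of c u] M[of u] \<open>\<epsilon> > 0\<close> \<open>M > 0\<close> by (intro mult_mono) auto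
      then show "norm ((g u - g c) * f' u) \<le> \<epsilon> / 2"
        using \<open>M > 0\<close> by (simp add: abs_mult)
    qed (use * in auto)
    also have "\<dots> \<le> \<epsilon> / 2 * (w d - w c)"
      using controlD[OF w_id, of c d] * \<open>\<epsilon> > 0\<close> by (intro mult_left_mono) auto
    finally have b1: "\<bar>integral {c..d} (\<lambda>u. (g u - g c) * f' u)\<bar> \<le> \<epsilon> / 2 * (w d - w c)" by simp
    have "\<bar>f d - f s\<bar> * \<bar>g d - g c\<bar> \<le> \<epsilon> / 2 * (w d - w c)"
      using * 1[of s d] controlD[OF ctl, of c d] \<open>\<epsilon> > 0\<close> by (intro mult_mono) auto
    then have b2: "\<bar>(f d - f s) * (g d - g c)\<bar> \<le> \<epsilon> / 2 * (w d - w c)" by (simp add: abs_mult)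
    show "\<bar>(f d * g d - integral {a..d} (\<lambda>u. g u * f' u)) - (f c * g c - integral {a..c} (\<lambda>u. g u * f' u))
        - f s * (g d - g c)\<bar> \<le> \<epsilon> * (w d - w c)"
      unfolding eq using b1 b2 field_sum_of_halves[of "\<epsilon> * (w d - w c)"] by simp
  qed (use d in auto)
qed

section \<open>Existence and continuity for continuous integrands\<close>

lemma RS_primitive_diff_bound:
  assumes "RS_primitive f g w a b \<Phi>" "RS_primitive f' g w a b \<Phi>'" and ctl: "control a b w g"
    and M: "\<And>s. s \<in> {a..b} \<Longrightarrow> \<bar>f s - f' s\<bar> \<le> M" and cd: "a \<le> c" "c \<le> d" "d \<le> b"
  shows "\<bar>(\<Phi> d - \<Phi> c) - (\<Phi>' d - \<Phi>' c)\<bar> \<le> M * (w d - w c)"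
proof (rule has_RS_integral_bound[where w = w and a = c and b = d])
  show "has_RS_integral (\<lambda>s. f s - f' s) g c d ((\<Phi> d - \<Phi> c) - (\<Phi>' d - \<Phi>' c))"
    using assms by (intro has_RS_integral_diff has_RS_integral_of_primitive) auto
qed (use cd M control_subinterval[OF ctl] in auto)

text \<open>Polynomial approximations of \<open>f\<close> have primitives by integration by parts.
  Uniform closeness of integrands passes to increments of primitives with the factor
  \<open>w d - w c\<close>, so the primitives converge and the local estimate survives the
  limit.\<close>

lemma RS_primitive_exists:
  assumes f: "continuous_on {a..b} f" and g: "continuous_on {a..b} g"
    and ctl: "control a b w g" and w_id: "control a b w (\<lambda>t. t)"
  shows "\<exists>\<Phi>. RS_primitive f g w a b \<Phi>"
proof -
  have "\<exists>p \<Phi>. (\<forall>s\<in>{a..b}. \<bar>f s - p s\<bar> \<le> 1 / Suc n) \<and> \<Phi> a = 0 \<and> RS_primitive p g w a b \<Phi>" for n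
  proof -
    obtain p where p: "real_polynomial_function p" "\<And>s. s \<in> {a..b} \<Longrightarrow> \<bar>f s - p s\<bar> < 1 / Suc n"
      using Stone_Weierstrass_real_polynomial_function[of "{a..b}" f "1 / Suc n"] f by auto
    obtain p' where p': "real_polynomial_function p'" "\<And>t. (p has_real_derivative p' t) (at t)"
      using has_real_derivative_polynomial_function[OF p(1)] by blast
    have "continuous_on {a..b} p'"
      using p'(1) by (simp add: continuous_on_polymonial_function real_polynomial_function_eq)
    from RS_primitive_smooth[OF p'(2) this g ctl w_id] obtain \<Phi> where "RS_primitive p g w a b \<Phi>"
      by blast
    \<comment> \<open>With value 0 at \<open>a\<close>, estimates on increments become estimates on
      values.\<close>
    then have "RS_primitive p g w a b (\<lambda>t. \<Phi> t - \<Phi> a)"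
      by (simp add: RS_primitive_def)
    with p(2) show ?thesis by (intro exI[of _ p] exI[of _ "\<lambda>t. \<Phi> t - \<Phi> a"]) (simp add: less_imp_le)
  qed
  then obtain p \<Phi> where p: "\<And>n s. s \<in> {a..b} \<Longrightarrow> \<bar>f s - p n s\<bar> \<le> 1 / Suc n"
    and \<Phi>0: "\<And>n. \<Phi> n a = 0" and \<Phi>: "\<And>n. RS_primitive (p n) g w a b (\<Phi> n)"
    by metis
  have diff: "\<bar>(\<Phi> m d - \<Phi> m c) - (\<Phi> n d - \<Phi> n c)\<bar> \<le> (1 / Suc m + 1 / Suc n) * (w d - w c)"
    if "a \<le> c" "c \<le> d" "d \<le> b" for m n c d
  proof (rule RS_primitive_diff_bound[OF \<Phi> \<Phi> ctl _ that])
    fix s assume "s \<in> {a..b}"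
    then show "\<bar>p m s - p n s\<bar> \<le> 1 / Suc m + 1 / Suc n" using p[of s m] p[of s n] by linarith
  qed
  have conv: "convergent (\<lambda>n. \<Phi> n t)" if t: "t \<in> {a..b}" for t
  proof -
    have "Cauchy (\<lambda>n. \<Phi> n t)"
    proof (rule CauchyI')
      fix \<epsilon> :: real assume "\<epsilon> > 0"
      let ?W = "w t - w a"
      have W: "?W \<ge> 0" using control_nonneg[OF ctl, of a t] t by auto
      then obtain N where N: "2 * ?W / \<epsilon> < real N" using reals_Archimedean2 by blast
      have "dist (\<Phi> m t) (\<Phi> n t) < \<epsilon>" if "m \<ge> N" "n > m" for m n
      proof -
        have "dist (\<Phi> m t) (\<Phi> n t) \<le> (1 / Suc m + 1 / Suc n) * ?W"
          using diff[of a t m n] t \<Phi>0 by (simp add: dist_real_def)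
        also have "\<dots> \<le> (1 / Suc N + 1 / Suc N) * ?W"
          using that W by (intro mult_right_mono add_mono) (auto simp: field_simps)
        also have "\<dots> < \<epsilon>" using N \<open>\<epsilon> > 0\<close> by (simp add: field_simps)
        finally show ?thesis .
      qed
      then show "\<exists>M. \<forall>m\<ge>M. \<forall>n>m. dist (\<Phi> m t) (\<Phi> n t) < \<epsilon>" by blast
    qed
    then show ?thesis by (simp add: Cauchy_convergent_iff)
  qed
  define \<Psi> where "\<Psi> t = lim (\<lambda>n. \<Phi> n t)" for t
  have lim: "(\<lambda>n. \<Phi> n t) \<longlonglongrightarrow> \<Psi> t" if "t \<in> {a..b}" for t
    using conv[OF that] by (simp add: \<Psi>_def convergent_LIMSEQ_iff)
  have close: "\<bar>(\<Psi> d - \<Psi> c) - (\<Phi> n d - \<Phi> n c)\<bar> \<le> 1 / Suc n * (w d - w c)"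
    if "a \<le> c" "c \<le> d" "d \<le> b" for n c d
  proof (rule LIMSEQ_le)
    show "(\<lambda>m. \<bar>(\<Phi> m d - \<Phi> m c) - (\<Phi> n d - \<Phi> n c)\<bar>) \<longlonglongrightarrow> \<bar>(\<Psi> d - \<Psi> c) - (\<Phi> n d - \<Phi> n c)\<bar>"
      using that by (intro tendsto_intros lim) auto
    have "(\<lambda>m. (1 / Suc m + 1 / Suc n) * (w d - w c)) \<longlonglongrightarrow> (0 + 1 / Suc n) * (w d - w c)"
      by (intro tendsto_intros LIMSEQ_Suc[OF lim_1_over_n])
    then show "(\<lambda>m. (1 / Suc m + 1 / Suc n) * (w d - w c)) \<longlonglongrightarrow> 1 / Suc n * (w d - w c)" by simp
  qed (use diff that in blast)
  have "RS_primitive f g w a b \<Psi>"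
    unfolding RS_primitive_def
  proof (intro allI impI)
    fix \<epsilon> :: real assume "\<epsilon> > 0"
    \<comment> \<open>One third each for passing from \<open>\<Psi>\<close> to
      \<open>\<Phi> n\<close>, for the local estimate of \<open>\<Phi> n\<close>, and for replacing
      \<open>p n\<close> by \<open>f\<close> at the tag.\<close>
    obtain n where n: "1 / Suc n < \<epsilon> / 3"
      using nat_approx_posE[of "\<epsilon> / 3"] \<open>\<epsilon> > 0\<close> by auto
    obtain \<delta> where "\<delta> > 0" and \<delta>: "\<And>c s d. a \<le> c \<Longrightarrow> c \<le> s \<Longrightarrow> s \<le> d \<Longrightarrow> d \<le> b \<Longrightarrow> d - c < \<delta> \<Longrightarrow>
      \<bar>\<Phi> n d - \<Phi> n c - p n s * (g d - g c)\<bar> \<le> \<epsilon> / 3 * (w d - w c)"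
      using RS_primitiveE[OF \<Phi>[of n], of "\<epsilon> / 3"] \<open>\<epsilon> > 0\<close> by auto
    show "\<exists>\<delta>>0. \<forall>c s d. a \<le> c \<longrightarrow> c \<le> s \<longrightarrow> s \<le> d \<longrightarrow> d \<le> b \<longrightarrow> d - c < \<delta> \<longrightarrow>
      \<bar>\<Psi> d - \<Psi> c - f s * (g d - g c)\<bar> \<le> \<epsilon> * (w d - w c)"
    proof (intro exI[of _ \<delta>] conjI allI impI)
      fix c s d assume *: "a \<le> c" "c \<le> s" "s \<le> d" "d \<le> b" "d - c < \<delta>"
      then have W: "w d - w c \<ge> 0" using control_nonneg[OF ctl, of c d] by auto
      have "1 / Suc n * (w d - w c) \<le> \<epsilon> / 3 * (w d - w c)"
        using n W by (intro mult_right_mono) auto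
      then have 1: "\<bar>(\<Psi> d - \<Psi> c) - (\<Phi> n d - \<Phi> n c)\<bar> \<le> \<epsilon> / 3 * (w d - w c)"
        using close[of c d n] * by linarith
      have "\<bar>f s - p n s\<bar> * \<bar>g d - g c\<bar> \<le> \<epsilon> / 3 * (w d - w c)"
        using p[of s n] n * controlD[OF ctl, of c d] \<open>\<epsilon> > 0\<close> by (intro mult_mono) auto
      then have 2: "\<bar>f s * (g d - g c) - p n s * (g d - g c)\<bar> \<le> \<epsilon> / 3 * (w d - w c)"
        by (simp add: abs_mult[symmetric] left_diff_distrib)
      have "\<epsilon> * (w d - w c) = \<epsilon> / 3 * (w d - w c) + \<epsilon> / 3 * (w d - w c) + \<epsilon> / 3 * (w d - w c)"
        by (simp add: field_simps)
      with 1 2 \<delta>[OF *] show "\<bar>\<Psi> d - \<Psi> c - f s * (g d - g c)\<bar> \<le> \<epsilon> * (w d - w c)"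
        by linarith
    qed (use \<open>\<delta> > 0\<close> in auto)
  qed
  then show ?thesis by blast
qed

text \<open>Tagging at \<open>c\<close> splits an increment of \<open>\<Phi>\<close> into
  \<open>f c * (g d - g c)\<close>, small by continuity of \<open>g\<close>, and an error. As
  \<open>w\<close> may jump, the error is made small through \<open>\<eta>\<close>, with the
  increment of \<open>w\<close> bounded by its total.\<close>

lemma RS_primitive_continuous:
  assumes \<Phi>: "RS_primitive f g w a b \<Phi>" and ctl: "control a b w g"
    and f: "continuous_on {a..b} f" and g: "continuous_on {a..b} g"
  shows "continuous_on {a..b} \<Phi>"
proof (cases "a \<le> b")
  case True
  have W: "w b - w a \<ge> 0" using control_nonneg[OF ctl, of a b] True by auto
  have "bounded (f ` {a..b})"
    using f by (intro compact_imp_bounded compact_continuous_image) auto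
  then obtain M where "M > 0" and M: "\<And>t. t \<in> {a..b} \<Longrightarrow> \<bar>f t\<bar> \<le> M"
    unfolding bounded_pos by auto
  have "uniformly_continuous_on {a..b} \<Phi>"
    unfolding uniformly_continuous_on_def
  proof (intro allI impI)
    fix \<epsilon> :: real assume "\<epsilon> > 0"
    define \<eta> where "\<eta> = \<epsilon> / (2 * (w b - w a + 1))"
    have "\<eta> > 0" using W \<open>\<epsilon> > 0\<close> by (simp add: \<eta>_def)
    then obtain \<delta>1 where "\<delta>1 > 0" and \<delta>1: "\<And>c s d. a \<le> c \<Longrightarrow> c \<le> s \<Longrightarrow> s \<le> d \<Longrightarrow> d \<le> b \<Longrightarrow> d - c < \<delta>1 \<Longrightarrow>
      \<bar>\<Phi> d - \<Phi> c - f s * (g d - g c)\<bar> \<le> \<eta> * (w d - w c)"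
      by (rule RS_primitiveE[OF \<Phi>]) blast
    have "uniformly_continuous_on {a..b} g" "\<epsilon> / (2 * M) > 0"
      using g \<open>\<epsilon> > 0\<close> \<open>M > 0\<close> by (auto intro: compact_uniformly_continuous)
    then obtain \<delta>2 where "\<delta>2 > 0"
      and \<delta>2: "\<And>s t. s \<in> {a..b} \<Longrightarrow> t \<in> {a..b} \<Longrightarrow> \<bar>t - s\<bar> < \<delta>2 \<Longrightarrow> \<bar>g t - g s\<bar> < \<epsilon> / (2 * M)"
      unfolding uniformly_continuous_on_def dist_real_def by metis
    have ordered: "\<bar>\<Phi> d - \<Phi> c\<bar> < \<epsilon>" if "a \<le> c" "c \<le> d" "d \<le> b" "d - c < min \<delta>1 \<delta>2" for c d
    proof -
      have "w d - w c \<le> w b - w a"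
        using control_nonneg[OF ctl, of a c] control_nonneg[OF ctl, of d b] that by auto
      then have "\<eta> * (w d - w c) \<le> \<eta> * (w b - w a)" using \<open>\<eta> > 0\<close> by (intro mult_left_mono) auto
      also have "\<dots> < \<epsilon> / 2" using W \<open>\<epsilon> > 0\<close> by (simp add: \<eta>_def field_simps)
      finally have 1: "\<bar>\<Phi> d - \<Phi> c - f c * (g d - g c)\<bar> < \<epsilon> / 2"
        using \<delta>1[of c c d] that by auto
      have "\<bar>f c\<bar> * \<bar>g d - g c\<bar> \<le> M * (\<epsilon> / (2 * M))"
        using M[of c] \<delta>2[of c d] that \<open>M > 0\<close> by (intro mult_mono) auto
      then have "\<bar>f c * (g d - g c)\<bar> \<le> \<epsilon> / 2" using \<open>M > 0\<close> by (simp add: abs_mult)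
      with 1 show ?thesis by linarith
    qed
    show "\<exists>\<delta>>0. \<forall>x\<in>{a..b}. \<forall>x'\<in>{a..b}. dist x' x < \<delta> \<longrightarrow> dist (\<Phi> x') (\<Phi> x) < \<epsilon>"
    proof (intro exI[of _ "min \<delta>1 \<delta>2"] conjI ballI impI)
      fix s t assume st: "s \<in> {a..b}" "t \<in> {a..b}" "dist t s < min \<delta>1 \<delta>2"
      then show "dist (\<Phi> t) (\<Phi> s) < \<epsilon>"
        using ordered[of s t] ordered[of t s] by (auto simp: dist_real_def abs_if split: if_splits)
    qed (use \<open>\<delta>1 > 0\<close> \<open>\<delta>2 > 0\<close> in auto)
  qed
  then show ?thesis by (rule uniformly_continuous_imp_continuous)
qed auto

section \<open>Signatures of paths of finite variation\<close>

text \<open>Strictness of \<open>c < d\<close> ensures that the appended interval is new, so a sum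
  over the division gains exactly one term.\<close>

lemma division_of_insert_right:
  fixes a c d :: real
  assumes P: "P division_of {a..c}" and "a \<le> c" "c < d"
  shows "insert {c..d} P division_of {a..d}" "{c..d} \<notin> P" "finite P"
proof -
  have "{{c..d}} division_of {c..d}"
    using division_of_self[of c d] \<open>c < d\<close> by (simp add: box_real)
  moreover have "interior {c..d} \<inter> interior {a..c} = {}" by (auto simp: interior_atLeastAtMost_real)
  ultimately have "{{c..d}} \<union> P division_of {c..d} \<union> {a..c}"
    by (intro division_disjoint_union P)
  moreover have "{c..d} \<union> {a..c} = {a..d}" using assms by auto
  ultimately show "insert {c..d} P division_of {a..d}" by simp
  show "finite P" using P by (rule division_ofD)
  show "{c..d} \<notin> P"
    using division_ofD(2)[OF P, of "{c..d}"] \<open>c < d\<close> by auto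
qed

text \<open>The variation function \<open>V\<close> is superadditive: appending the interval from
  \<open>c\<close> to \<open>d\<close> to any division up to \<open>c\<close> gives a competitor in
  the supremum defining \<open>V d\<close>.\<close>

lemma finite_1_variation_on_imp_control:
  fixes x :: "real \<Rightarrow> real^'k"
  assumes "finite_1_variation_on 0 1 x"
  obtains w where "control 0 1 w (\<lambda>t. t)" "\<And>j. control 0 1 w (\<lambda>t. x t $ j)"
proof -
  define S where "S P = (\<Sum>K\<in>P. norm (x (Sup K) - x (Inf K)))" for P
  define V where "V t = Sup {S P | P. P division_of {0..t}}" for t :: real
  have S_insert: "S (insert {c..d} P) = norm (x d - x c) + S P"
    if "P division_of {0..c}" "0 \<le> c" "c < d" for P c d
    using division_of_insert_right[OF that] that by (simp add: S_def)
  have "bdd_above {S P | P. P division_of {0..1}}"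
    using assms by (simp add: finite_1_variation_on_def S_def)
  then obtain B where B: "\<And>P. P division_of {0..1} \<Longrightarrow> S P \<le> B"
    unfolding bdd_above_def by auto
  \<comment> \<open>Appending the interval from \<open>t\<close> to 1 yields a division of the whole
    interval, so the bound \<open>B\<close> is inherited.\<close>
  have bdd: "bdd_above {S P | P. P division_of {0..t}}" if "0 \<le> t" "t \<le> 1" for t
  proof -
    have "S P \<le> B" if P: "P division_of {0..t}" for P
    proof (cases "t = 1")
      case False
      then have "t < 1" using \<open>t \<le> 1\<close> by simp
      from B[OF division_of_insert_right(1)[OF P \<open>0 \<le> t\<close> this]] S_insert[OF P \<open>0 \<le> t\<close> this]
      show ?thesis using norm_ge_zero[of "x 1 - x t"] by linarith
    qed (use B P in simp)
    then show ?thesis by (intro bdd_aboveI[of _ B]) auto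
  qed
  have V: "norm (x d - x c) \<le> V d - V c" if cd: "0 \<le> c" "c \<le> d" "d \<le> 1" for c d
  proof (cases "c = d")
    case False
    with cd have "c < d" by simp
    have "V c \<le> V d - norm (x d - x c)"
      unfolding V_def[of c]
    proof (rule cSup_least)
      have "{{0..c}} division_of {0..c}"
        using division_of_self[of 0 c] cd by (simp add: box_real)
      then show "{S P | P. P division_of {0..c}} \<noteq> {}" by blast
      fix y assume "y \<in> {S P | P. P division_of {0..c}}"
      then obtain P where y: "y = S P" and P: "P division_of {0..c}" by blast
      have "S (insert {c..d} P) \<le> V d"
        unfolding V_def using division_of_insert_right(1)[OF P cd(1) \<open>c < d\<close>] bdd[of d] cd
        by (intro cSup_upper) auto
      then show "y \<le> V d - norm (x d - x c)"
        using S_insert[OF P cd(1) \<open>c < d\<close>] y by simp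
    qed
    then show ?thesis by simp
  qed simp
  define w where "w t = V t + t" for t \<comment> \<open>\<open>V\<close> alone need not control the identity\<close>
  show ?thesis
  proof (rule that[of w])
    show "control 0 1 w (\<lambda>t. t)"
      unfolding control_def w_def
    proof (intro allI impI)
      fix c d :: real assume "0 \<le> c" "c \<le> d" "d \<le> 1"
      with V[of c d] norm_ge_zero[of "x d - x c"]
      show "\<bar>d - c\<bar> \<le> V d + d - (V c + c)" by linarith
    qed
    show "control 0 1 w (\<lambda>t. x t $ j)" for j
      unfolding control_def w_def
    proof (intro allI impI)
      fix c d :: real assume "0 \<le> c" "c \<le> d" "d \<le> 1"
      with V[of c d] component_le_norm_cart[of "x d - x c" j]
      show "\<bar>x d $ j - x c $ j\<bar> \<le> V d + d - (V c + c)" by simp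
    qed
  qed
qed

text \<open>A single \<open>w\<close> serves all coordinates and the identity. Asking for some
  control rather than the exact variation lets the axis path use an explicit linear one.\<close>

locale controlled_path =
  fixes x :: "real \<Rightarrow> real^'k" and w :: "real \<Rightarrow> real"
  assumes continuous: "\<And>j. continuous_on {0..1} (\<lambda>t. x t $ j)"
    and control: "\<And>j. control 0 1 w (\<lambda>t. x t $ j)"
    and control_id: "control 0 1 w (\<lambda>t. t)"
begin

text \<open>Existence of one integral needs continuity of the previous one and supplies continuity
  for the next, so both come from the same primitive.\<close>

lemma has_RS_integral_Cons_and_continuous:
  assumes f: "continuous_on {0..1} (rev_signature x J)"
  shows "continuous_on {0..1} (rev_signature x (j # J))"
    and "t \<in> {0..1} \<Longrightarrow> has_RS_integral (rev_signature x J) (\<lambda>s. x s $ j) 0 t (rev_signature x (j # J) t)"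
proof -
  obtain \<Phi> where \<Phi>: "RS_primitive (rev_signature x J) (\<lambda>s. x s $ j) w 0 1 \<Phi>"
    using RS_primitive_exists[OF f continuous control control_id] by blast
  have int: "has_RS_integral (rev_signature x J) (\<lambda>s. x s $ j) 0 t (\<Phi> t - \<Phi> 0)" if "t \<in> {0..1}" for t
    using has_RS_integral_of_primitive[OF \<Phi> control] that by simp
  then have eq: "rev_signature x (j # J) t = \<Phi> t - \<Phi> 0" if "t \<in> {0..1}" for t
    using that by (simp add: RS_integral_eqI)
  have "continuous_on {0..1} (\<lambda>t. \<Phi> t - \<Phi> 0)"
    using RS_primitive_continuous[OF \<Phi> control f continuous] by (intro continuous_intros)
  then show "continuous_on {0..1} (rev_signature x (j # J))"
    by (rule continuous_on_eq) (use eq in simp)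
  show "has_RS_integral (rev_signature x J) (\<lambda>s. x s $ j) 0 t (rev_signature x (j # J) t)" if "t \<in> {0..1}"
    using int[OF that] eq[OF that] by simp
qed

lemma continuous_rev_signature: "continuous_on {0..1} (rev_signature x J)"
proof (induction J)
  case (Cons j J)
  then show ?case by (rule has_RS_integral_Cons_and_continuous)
qed simp

lemmas has_RS_integral_rev_signature =
  has_RS_integral_Cons_and_continuous(2)[OF continuous_rev_signature]

text \<open>Replacing \<open>w t - w 0\<close> by \<open>w 1 - w 0\<close> at each level loses the
  factorial decay but keeps the induction to one line of estimates.\<close>

lemma rev_signature_bound: "t \<in> {0..1} \<Longrightarrow> \<bar>rev_signature x J t\<bar> \<le> (w 1 - w 0) ^ length J"
proof (induction J arbitrary: t)
  case (Cons j J)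
  have W: "0 \<le> w t - w 0" "w t - w 0 \<le> w 1 - w 0"
    using control_nonneg[OF control_id, of 0 t] control_nonneg[OF control_id, of t 1] Cons.prems by auto
  have "\<bar>rev_signature x (j # J) t\<bar> \<le> (w 1 - w 0) ^ length J * (w t - w 0)"
    using Cons.prems
    by (intro has_RS_integral_bound[OF has_RS_integral_rev_signature _ control_subinterval[OF control]] Cons.IH) auto
  also have "\<dots> \<le> (w 1 - w 0) ^ length J * (w 1 - w 0)"
    using W by (intro mult_left_mono) auto
  finally show ?case by (simp add: mult.commute)
qed simp

lemma signature_bound: "\<bar>signature x J\<bar> \<le> (w 1 - w 0) ^ length J"
  using rev_signature_bound[of 1 "rev J"] by (simp add: signature_def)

end

lemma C1_path_imp_controlled:
  assumes "C1_path x"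
  obtains w where "controlled_path x w"
proof -
  obtain w where "control 0 1 w (\<lambda>t. t)" "\<And>j. control 0 1 w (\<lambda>t. x t $ j)"
    using finite_1_variation_on_imp_control[of x] assms unfolding C1_path_def by blast
  then have "controlled_path x w"
    using assms by unfold_locales (auto simp: C1_path_def intro!: continuous_intros)
  then show ?thesis by (rule that)
qed

section \<open>Signatures of selected and rescaled paths\<close>

lemma signature_select_path: "signature (select_path I x) J = signature x (map I J)"
proof -
  have "rev_signature (select_path I x) J = rev_signature x (map I J)" for J
    by (induction J) (simp_all add: select_path_def)
  then show ?thesis by (simp add: signature_def rev_map)
qed

text \<open>Writing the product by coordinates with exponents, not by letters, lets a partial
  derivative act on a single factor.\<close>

definition monomial :: "'n list \<Rightarrow> real^'n \<Rightarrow> real"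
  where "monomial J q = (\<Prod>i\<in>UNIV. q $ i ^ count_list J i)"

lemma monomial_Cons: "monomial (j # J) q = q $ j * monomial J q"
proof -
  have "monomial (j # J) q = (\<Prod>i\<in>UNIV. (if i = j then q $ i else 1) * q $ i ^ count_list J i)"
    unfolding monomial_def by (intro prod.cong) auto
  then show ?thesis by (simp add: prod.distrib monomial_def)
qed

lemma scale_path_nth: "scale_path l z t $ j = l $ j * z t $ j"
  by (simp add: scale_path_def)

lemma (in controlled_path) signature_scale_path:
  "signature (scale_path l x) J = monomial J l * signature x J"
proof -
  have "rev_signature (scale_path l x) J t = monomial J l * rev_signature x J t" if "t \<in> {0..1}" for J t
    using that
  proof (induction J arbitrary: t)
    case (Cons j J)
    have "has_RS_integral (\<lambda>s. monomial J l * rev_signature x J s) (\<lambda>s. l $ j * x s $ j) 0 t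
        (monomial J l * l $ j * rev_signature x (j # J) t)"
      by (rule has_RS_integral_cmult[OF has_RS_integral_rev_signature[OF Cons.prems]])
    \<comment> \<open>The induction hypothesis is available only on \<open>{0..1}\<close>; the
      integral over \<open>{0..t}\<close> sees no other values.\<close>
    moreover have "has_RS_integral (\<lambda>s. monomial J l * rev_signature x J s) (\<lambda>s. l $ j * x s $ j) 0 t v
      \<longleftrightarrow> has_RS_integral (rev_signature (scale_path l x) J) (\<lambda>s. scale_path l x s $ j) 0 t v" for v
      using Cons.prems by (intro has_RS_integral_cong) (auto simp: Cons.IH scale_path_nth)
    ultimately have "rev_signature (scale_path l x) (j # J) t = monomial J l * l $ j * rev_signature x (j # J) t"
      by (simp add: RS_integral_eqI)
    then show ?case by (simp add: monomial_Cons mult.commute del: rev_signature.simps)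
  qed (simp add: monomial_def)
  from this[of 1 "rev J"] show ?thesis by (simp add: signature_def monomial_def)
qed

section \<open>The axis path\<close>

lemma index_list_props:
  "set (index_list :: 'n::{finite,linorder} list) = UNIV" "distinct (index_list :: 'n list)"
  "sorted_wrt (<) (index_list :: 'n list)" "length (index_list :: 'n list) = CARD('n)"
  by (simp_all add: index_list_def)

text \<open>Positions are zero-based: with p for \<open>index_pos j\<close>, coordinate
  \<open>j\<close> of the axis path moves exactly between the times p/n and (p+1)/n.\<close>

definition index_pos :: "'n::{finite,linorder} \<Rightarrow> nat"
  where "index_pos j = (SOME p. p < CARD('n) \<and> index_list ! p = j)"

lemma index_pos: "index_pos j < CARD('n)" "index_list ! index_pos j = j" for j :: "'n::{finite,linorder}"
proof -
  have "\<exists>p. p < CARD('n) \<and> index_list ! p = j"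
    using UNIV_I[of j] unfolding index_list_props(1)[symmetric] in_set_conv_nth index_list_props(4) .
  then have "index_pos j < CARD('n) \<and> index_list ! index_pos j = j"
    unfolding index_pos_def by (rule someI_ex)
  then show "index_pos j < CARD('n)" "index_list ! index_pos j = j" by auto
qed

lemma index_pos_less:
  fixes i j :: "'n::{finite,linorder}"
  shows "i < j \<Longrightarrow> index_pos i < index_pos j"
proof (rule ccontr)
  assume "i < j" "\<not> index_pos i < index_pos j"
  then have "(index_list ! index_pos j :: 'n) \<le> index_list ! index_pos i"
    by (intro sorted_nth_mono) (simp_all add: index_list_props index_pos strict_sorted_imp_sorted)
  then show False using \<open>i < j\<close> by (simp add: index_pos)
qed

lemma sum_list_axis_nth:
  "distinct L \<Longrightarrow> sum_list (map (\<lambda>i. axis i (1 :: real)) L) $ j = (if j \<in> set L then 1 else 0)"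
  by (induction L) (auto simp: axis_def)

lemma axis_path_nth:
  fixes j :: "'n::{finite,linorder}"
  assumes t: "t \<in> {0..1}"
  shows "axis_path t $ j = max 0 (min 1 (real CARD('n) * t - index_pos j))"
proof -
  define n where "n = CARD('n)"
  define L :: "'n list" where "L = index_list"
  define i where "i = nat \<lfloor>real n * t\<rfloor>"
  define p where "p = index_pos j"
  have L: "length L = n" "distinct L" by (simp_all add: L_def n_def index_list_props)
  have p: "p < n" "L ! p = j" using index_pos[of j] by (auto simp: p_def n_def L_def)
  have nt: "0 \<le> real n * t" "real n * t \<le> n"
    using t by (auto intro: mult_left_le)
  have i: "real i \<le> real n * t" "real n * t < real i + 1"
    unfolding i_def using nt(1) by linarith+
  then have "i \<le> n" using nt by linarith
  have mem: "j \<in> set (take i L) \<longleftrightarrow> p < i"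
  proof
    assume "j \<in> set (take i L)"
    then obtain q where "q < i" "q < n" "L ! q = j"
      using L by (auto simp: in_set_conv_nth)
    moreover then have "q = p" using L p nth_eq_iff_index_eq[of L q p] by simp
    ultimately show "p < i" by simp
  next
    assume "p < i"
    then show "j \<in> set (take i L)" using p L \<open>i \<le> n\<close>
      by (auto simp: in_set_conv_nth intro!: exI[of _ p])
  qed
  have sum: "sum_list (take i (map (\<lambda>i. axis i (1::real)) L)) $ j = (if p < i then 1 else 0)"
    using sum_list_axis_nth[of "take i L" j] L mem by (simp add: take_map)
  have last: "(real n * t - real i) * (map (\<lambda>i. axis i (1::real)) L ! i) $ j
      = (if p = i then real n * t - real i else 0)"
  proof (cases "i = n")
    \<comment> \<open>This is \<open>t = 1\<close>: the list entry is out of range, but its factor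
      \<open>real n * t - real i\<close> is 0.\<close>
    case True
    then show ?thesis using nt i p by simp
  next
    case False
    then have "i < n" using \<open>i \<le> n\<close> by simp
    then have "L ! i = j \<longleftrightarrow> i = p" using L p nth_eq_iff_index_eq[of L i p] by auto
    then show ?thesis using \<open>i < n\<close> L by (auto simp: axis_def)
  qed
  have "axis_path t $ j = sum_list (take i (map (\<lambda>i. axis i (1::real)) L)) $ j
      + (real n * t - real i) * (map (\<lambda>i. axis i (1::real)) L ! i) $ j"
    unfolding axis_path_def concat_linear_def using L
    by (simp add: Let_def L_def[symmetric] i_def[symmetric])
  also have "\<dots> = max 0 (min 1 (real n * t - p))"
    unfolding sum last using i by (auto simp: max_def min_def)
  finally show ?thesis by (simp add: n_def p_def)
qed

text \<open>Every coordinate is a ramp of slope \<open>CARD('n)\<close> clamped to the unit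
  interval, and \<open>CARD('n)\<close> is at least 1, which covers the identity.\<close>

lemma controlled_axis_path:
  "controlled_path (axis_path :: real \<Rightarrow> real^'n::{finite,linorder}) (\<lambda>t. real CARD('n) * t)"
proof
  fix j :: 'n
  have "continuous_on {0..1} (\<lambda>t. max 0 (min 1 (real CARD('n) * t - index_pos j)))"
    by (intro continuous_intros)
  then show "continuous_on {0..1} (\<lambda>t. axis_path t $ j)"
    by (rule continuous_on_eq) (simp add: axis_path_nth)
  show "control 0 1 (\<lambda>t. real CARD('n) * t) (\<lambda>t. axis_path t $ j)"
    unfolding control_def
  proof (intro allI impI)
    fix c d :: real assume cd: "0 \<le> c" "c \<le> d" "d \<le> 1"
    then have "real CARD('n) * c \<le> real CARD('n) * d" by (intro mult_left_mono) auto
    moreover have "u \<le> v \<Longrightarrow> \<bar>max 0 (min 1 (v - p)) - max 0 (min 1 (u - p))\<bar> \<le> v - u" for u v p :: real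
      by (simp add: max_def min_def)
    note this[of "real CARD('n) * c" "real CARD('n) * d" "index_pos j"]
    ultimately show "\<bar>axis_path d $ j - axis_path c $ j\<bar> \<le> real CARD('n) * d - real CARD('n) * c"
      using cd by (simp add: axis_path_nth)
  qed
  show "control 0 1 (\<lambda>t. real CARD('n) * t) (\<lambda>t. t)"
    unfolding control_def
  proof (intro allI impI)
    fix c d :: real assume cd: "0 \<le> c" "c \<le> d" "d \<le> 1"
    have "1 * (d - c) \<le> real CARD('n) * (d - c)"
      using cd by (intro mult_right_mono) (auto simp: Suc_le_eq)
    then show "\<bar>d - c\<bar> \<le> real CARD('n) * d - real CARD('n) * c"
      using cd by (simp add: right_diff_distrib)
  qed
qed

interpretation axis_path: controlled_path "axis_path :: real \<Rightarrow> real^'n::{finite,linorder}" "\<lambda>t. real CARD('n) * t"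
  by (rule controlled_axis_path)

section \<open>Signature of the axis path\<close>

text \<open>A short interval on which \<open>g\<close> has a nonzero increment contains a point
  where \<open>f\<close> is \<open>\<kappa>\<close>, so uniform continuity puts the tag value close
  to \<open>\<kappa>\<close>. This avoids splitting the integral at the nodes of the path.\<close>

lemma RS_primitive_const_on_support:
  assumes f: "continuous_on {a..b} f" and ctl: "control a b w g"
    and supp: "\<And>c d. a \<le> c \<Longrightarrow> c \<le> d \<Longrightarrow> d \<le> b \<Longrightarrow> g c \<noteq> g d \<Longrightarrow> \<exists>u\<in>{c..d}. f u = \<kappa>"
  shows "RS_primitive f g w a b (\<lambda>t. \<kappa> * g t)"
  unfolding RS_primitive_def
proof (intro allI impI)
  fix \<epsilon> :: real assume "\<epsilon> > 0"
  have "uniformly_continuous_on {a..b} f"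
    using f by (auto intro: compact_uniformly_continuous)
  with \<open>\<epsilon> > 0\<close> obtain \<delta> where "\<delta> > 0"
    and \<delta>: "\<And>s t. s \<in> {a..b} \<Longrightarrow> t \<in> {a..b} \<Longrightarrow> \<bar>t - s\<bar> < \<delta> \<Longrightarrow> \<bar>f t - f s\<bar> < \<epsilon>"
    unfolding uniformly_continuous_on_def dist_real_def by metis
  show "\<exists>\<delta>>0. \<forall>c s d. a \<le> c \<longrightarrow> c \<le> s \<longrightarrow> s \<le> d \<longrightarrow> d \<le> b \<longrightarrow> d - c < \<delta> \<longrightarrow>
      \<bar>\<kappa> * g d - \<kappa> * g c - f s * (g d - g c)\<bar> \<le> \<epsilon> * (w d - w c)"
  proof (intro exI[of _ \<delta>] conjI allI impI)
    fix c s d assume *: "a \<le> c" "c \<le> s" "s \<le> d" "d \<le> b" "d - c < \<delta>"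
    have "\<bar>(\<kappa> - f s) * (g d - g c)\<bar> \<le> \<epsilon> * (w d - w c)"
    proof (cases "g c = g d")
      case True
      then show ?thesis using control_nonneg[OF ctl, of c d] * \<open>\<epsilon> > 0\<close> by auto
    next
      case False
      then obtain u where u: "u \<in> {c..d}" "f u = \<kappa>" using supp[of c d] * by auto
      then have "\<bar>\<kappa> - f s\<bar> < \<epsilon>" using \<delta>[of s u] * by auto
      then show ?thesis
        unfolding abs_mult using controlD[OF ctl, of c d] * by (intro mult_mono) auto
    qed
    then show "\<bar>\<kappa> * g d - \<kappa> * g c - f s * (g d - g c)\<bar> \<le> \<epsilon> * (w d - w c)"
      by (simp add: algebra_simps)
  qed (use \<open>\<delta> > 0\<close> in auto)
qed

lemma axis_path_support:
  fixes j :: "'n::{finite,linorder}"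
  assumes cd: "0 \<le> c" "c \<le> d" "d \<le> 1" and ne: "axis_path c $ j \<noteq> axis_path d $ j"
  obtains u where "u \<in> {c..d}" "index_pos j \<le> real CARD('n) * u" "real CARD('n) * u \<le> index_pos j + 1"
proof -
  define n where "n = real CARD('n)"
  define p where "p = real (index_pos j)"
  have n: "n > 0" by (simp add: n_def)
  have ne': "max 0 (min 1 (n * c - p)) \<noteq> max 0 (min 1 (n * d - p))"
    using ne cd by (simp add: axis_path_nth n_def p_def)
  have le: "n * c \<le> n * d" using n cd by simp
  have d: "p < n * d"
    by (rule ccontr) (use ne' le in simp)
  have c: "n * c < p + 1"
    by (rule ccontr) (use ne' le in simp)
  \<comment> \<open>The witness is the first time in the interval at which the leg of
    \<open>j\<close> has started.\<close>
  have "max c (p / n) \<in> {c..d}"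
    using cd d n by (auto simp: field_simps)
  moreover have "p \<le> n * max c (p / n)" "n * max c (p / n) \<le> p + 1"
    using n c by (auto simp: max_def field_simps)
  ultimately show ?thesis using that[of "max c (p / n)"] by (simp add: n_def p_def)
qed

lemma axis_path_eq_1: "t \<in> {0..1} \<Longrightarrow> index_pos j + 1 \<le> real CARD('n) * t \<Longrightarrow> axis_path t $ j = 1"
  for j :: "'n::{finite,linorder}"
  by (simp add: axis_path_nth max_def min_def)

lemma axis_path_eq_0: "t \<in> {0..1} \<Longrightarrow> real CARD('n) * t \<le> index_pos j \<Longrightarrow> axis_path t $ j = 0"
  for j :: "'n::{finite,linorder}"
  by (simp add: axis_path_nth max_def min_def)

lemma prod_list_eq_1:
  "(\<And>i. i \<in> set J \<Longrightarrow> f i = 1) \<Longrightarrow> (\<Prod>i\<leftarrow>J. f i) = (1 :: 'a::monoid_mult)"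
  by (induction J) auto

text \<open>When the \<open>j\<close>-th coordinate moves, all earlier coordinates have already reached 1 and all
  later ones are still 0, so on the support of \<open>dz\<^sub>j\<close> the integrand is constant.\<close>

lemma rev_signature_axis_path:
  fixes J :: "'n::{finite,linorder} list"
  assumes "distinct J" "t \<in> {0..1}"
  shows "rev_signature axis_path J t
    = (if sorted_wrt (>) J then \<Prod>j\<leftarrow>J. axis_path t $ j else 0)"
  using assms
proof (induction J arbitrary: t)
  case (Cons j J)
  let ?z = "axis_path :: real \<Rightarrow> (real, 'n) vec"
  note int = axis_path.has_RS_integral_rev_signature[OF Cons.prems(2), of J j]
  have IH: "rev_signature ?z J s = (if sorted_wrt (>) J then \<Prod>j\<leftarrow>J. ?z s $ j else 0)" if "s \<in> {0..1}" for s
    using Cons.IH[OF _ that] Cons.prems by simp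
  have z0: "?z 0 $ j = 0" by (simp add: axis_path_nth)
  have const: "rev_signature ?z (j # J) t = \<kappa> * ?z t $ j"
    if "\<And>c d. 0 \<le> c \<Longrightarrow> c \<le> d \<Longrightarrow> d \<le> 1 \<Longrightarrow> ?z c $ j \<noteq> ?z d $ j \<Longrightarrow> \<exists>u\<in>{c..d}. rev_signature ?z J u = \<kappa>" for \<kappa>
  proof -
    have "RS_primitive (rev_signature ?z J) (\<lambda>s. ?z s $ j) (\<lambda>t. real CARD('n) * t) 0 1 (\<lambda>t. \<kappa> * ?z t $ j)"
      by (rule RS_primitive_const_on_support[OF axis_path.continuous_rev_signature axis_path.control that])
    from has_RS_integral_of_primitive[OF this axis_path.control, of 0 t] Cons.prems z0
    have "has_RS_integral (rev_signature ?z J) (\<lambda>s. ?z s $ j) 0 t (\<kappa> * ?z t $ j)" by simp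
    then show ?thesis using int by (rule has_RS_integral_unique[symmetric])
  qed
  \<comment> \<open>The integrand is constantly 0 if \<open>J\<close> is not decreasing. Otherwise,
    while \<open>j\<close> moves, it is 1 if all letters of \<open>J\<close> precede
    \<open>j\<close>, and 0 if some letter comes later.\<close>
  consider (unsorted) "\<not> sorted_wrt (>) J" | (sorted) "sorted_wrt (>) J" "\<forall>i\<in>set J. i < j"
    | (last) "sorted_wrt (>) J" "\<not> (\<forall>i\<in>set J. i < j)" by blast
  then show ?case
  proof cases
    case unsorted
    have "rev_signature ?z (j # J) t = 0 * ?z t $ j"
      by (rule const) (use IH unsorted in auto)
    then show ?thesis using unsorted by simp
  next
    case sorted
    have ones: "(\<Prod>i\<leftarrow>J. ?z u $ i) = 1" if u: "u \<in> {0..1}" "index_pos j \<le> real CARD('n) * u" for u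
    proof -
      have "?z u $ i = 1" if "i \<in> set J" for i
        using index_pos_less[of i j] sorted that u by (intro axis_path_eq_1) auto
      then show ?thesis by (rule prod_list_eq_1)
    qed
    have "rev_signature ?z (j # J) t = 1 * ?z t $ j"
    proof (rule const)
      fix c d assume cd: "0 \<le> c" "c \<le> d" "d \<le> 1" "?z c $ j \<noteq> ?z d $ j"
      then obtain u where u: "u \<in> {c..d}" "index_pos j \<le> real CARD('n) * u"
        by (rule axis_path_support)
      with cd have "u \<in> {0..1}" by auto
      with u ones[of u] sorted IH[of u] show "\<exists>u\<in>{c..d}. rev_signature ?z J u = 1" by auto
    qed
    \<comment> \<open>Before the leg of \<open>j\<close> starts both sides vanish; from then on all
      smaller coordinates equal 1.\<close>
    moreover have "?z t $ j = ?z t $ j * (\<Prod>i\<leftarrow>J. ?z t $ i)"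
    proof (cases "index_pos j \<le> real CARD('n) * t")
      case False
      then show ?thesis using axis_path_eq_0[of t j] Cons.prems by simp
    qed (use ones[of t] Cons.prems in simp)
    ultimately show ?thesis using sorted by simp
  next
    case last
    \<comment> \<open>The head of a decreasing list is its maximum, so it exceeds \<open>j\<close>;
      distinctness excludes equality.\<close>
    then obtain i J' where J: "J = i # J'" by (cases J) auto
    with last have "j < i" using Cons.prems(1) by (auto simp: not_less)
    have "rev_signature ?z (j # J) t = 0 * ?z t $ j"
    proof (rule const)
      fix c d assume cd: "0 \<le> c" "c \<le> d" "d \<le> 1" "?z c $ j \<noteq> ?z d $ j"
      then obtain u where u: "u \<in> {c..d}" "real CARD('n) * u \<le> index_pos j + 1"
        by (rule axis_path_support)
      with cd have "u \<in> {0..1}" by auto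
      moreover have "?z u $ i = 0"
        using u \<open>u \<in> {0..1}\<close> index_pos_less[OF \<open>j < i\<close>] by (intro axis_path_eq_0) auto
      ultimately have "rev_signature ?z J u = 0" unfolding IH[OF \<open>u \<in> {0..1}\<close>] using J by simp
      then show "\<exists>u\<in>{c..d}. rev_signature ?z J u = 0" using u by blast
    qed
    then show ?thesis using last by auto
  qed
qed simp

text \<open>The reversal in \<open>signature\<close> turns decreasing lists into increasing words,
  and \<open>index_list\<close> is the only increasing enumeration of all letters. At time 1 every
  coordinate equals 1.\<close>

lemma signature_axis_path_perm:
  fixes J :: "'n::{finite,linorder} list"
  assumes "distinct J" "set J = UNIV"
  shows "signature axis_path J = (if J = index_list then 1 else 0)"
proof -
  have "sorted_wrt (>) (rev J) \<longleftrightarrow> sorted_wrt (<) J"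
    by (simp add: sorted_wrt_rev)
  also have "\<dots> \<longleftrightarrow> J = index_list"
    using strict_sorted_equal[of J index_list] assms(2) by (auto simp: index_list_props)
  finally have "sorted_wrt (>) (rev J) \<longleftrightarrow> J = index_list" .
  moreover have "(\<Prod>j\<leftarrow>rev J. axis_path 1 $ j) = 1"
    using index_pos(1)
    by (intro prod_list_eq_1 axis_path_eq_1) (auto simp: Suc_le_eq simp flip: of_nat_Suc)
  ultimately show ?thesis
    unfolding signature_def using rev_signature_axis_path[of "rev J" 1] assms(1)
    by (simp only: distinct_rev atLeastAtMost_iff) simp
qed

section \<open>Mixed partial derivatives of power series\<close>

text \<open>For \<open>i \<in> A\<close> with \<open>count_list J i = 0\<close> the truncated exponent is harmless, since the
  coefficient vanishes.\<close>

definition monomial_deriv :: "'n set \<Rightarrow> 'n list \<Rightarrow> real^'n \<Rightarrow> real"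
  where "monomial_deriv A J q =
    (\<Prod>i\<in>UNIV. if i \<in> A then real (count_list J i) * q $ i ^ (count_list J i - 1) else q $ i ^ count_list J i)"

lemma monomial_deriv_empty: "monomial_deriv {} J q = monomial J q"
  by (simp add: monomial_deriv_def monomial_def)

text \<open>Only the factor of \<open>j\<close> varies along the line, and
  \<open>j \<notin> A\<close> means that it is still a plain power. The formula holds at every
  \<open>h\<close>, as termwise differentiation on an interval requires.\<close>

lemma monomial_deriv_has_derivative:
  assumes "j \<notin> A"
  shows "((\<lambda>h. monomial_deriv A J (q + h *\<^sub>R axis j 1)) has_real_derivative
    monomial_deriv (insert j A) J (q + h *\<^sub>R axis j 1)) (at h)"
proof -
  define R where "R = (\<Prod>i\<in>UNIV - {j}. if i \<in> A
    then real (count_list J i) * q $ i ^ (count_list J i - 1) else q $ i ^ count_list J i)"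
  have nth: "(q + h *\<^sub>R axis j 1) $ i = (if i = j then q $ i + h else q $ i)" for h i
    by (auto simp: axis_def)
  have R: "(\<Prod>i\<in>UNIV - {j}. if i \<in> A
      then real (count_list J i) * (if i = j then q $ i + h else q $ i) ^ (count_list J i - 1)
      else (if i = j then q $ i + h else q $ i) ^ count_list J i) = R" for h
    unfolding R_def by (rule prod.cong) auto
  have 1: "monomial_deriv A J (q + h *\<^sub>R axis j 1) = (q $ j + h) ^ count_list J j * R" for h
    unfolding monomial_deriv_def nth
    by (subst prod.remove[of _ j]) (simp_all add: assms R)
  have 2: "monomial_deriv (insert j A) J (q + h *\<^sub>R axis j 1)
      = real (count_list J j) * (q $ j + h) ^ (count_list J j - 1) * R" for h
    unfolding monomial_deriv_def nth
    by (subst prod.remove[of _ j]) (simp_all add: R cong: prod.cong_simp)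
  show ?thesis
    unfolding 1 2 by (auto intro!: derivative_eq_intros)
qed

text \<open>The exponent brought down by differentiation is absorbed by \<open>c < 2 ^ c\<close>;
  dividing by \<open>r\<close> accounts for the lost power.\<close>

lemma of_nat_mult_power_le:
  fixes r :: real
  assumes "r > 0" "\<bar>y\<bar> \<le> r"
  shows "\<bar>real c * y ^ (c - 1)\<bar> \<le> (2 * r) ^ c / r"
proof (cases c)
  case (Suc k)
  have "\<bar>real c * y ^ (c - 1)\<bar> = real c * \<bar>y\<bar> ^ k" using Suc by (simp add: abs_mult power_abs)
  also have "\<dots> \<le> 2 ^ c * r ^ k"
    using assms less_imp_le[OF of_nat_less_two_power[of c]]
    by (intro mult_mono power_mono) auto
  also have "\<dots> = (2 * r) ^ c / r" using Suc assms by (simp add: power_mult_distrib)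
  finally show ?thesis .
qed (use assms in simp)

text \<open>The constant in front depends on \<open>A\<close> but not on the word \<open>J\<close>,
  so it comes out of the sum over words.\<close>

lemma monomial_deriv_bound:
  fixes q :: "real^'n"
  assumes r: "r > 0" and q: "\<And>i. \<bar>q $ i\<bar> \<le> r"
  shows "\<bar>monomial_deriv A J q\<bar> \<le> (\<Prod>i\<in>(UNIV :: 'n set). if i \<in> A then 1 / r else 1) * (2 * r) ^ length J"
proof -
  have "\<bar>monomial_deriv A J q\<bar> \<le> (\<Prod>i\<in>(UNIV :: 'n set). (if i \<in> A then 1 / r else 1) * (2 * r) ^ count_list J i)"
    unfolding monomial_deriv_def abs_prod
  proof (rule prod_mono, intro conjI abs_ge_zero)
    fix i
    have "\<bar>q $ i\<bar> ^ count_list J i \<le> (2 * r) ^ count_list J i"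
      using q[of i] r by (intro power_mono) auto
    then show "\<bar>if i \<in> A then real (count_list J i) * q $ i ^ (count_list J i - 1) else q $ i ^ count_list J i\<bar>
        \<le> (if i \<in> A then 1 / r else 1) * (2 * r) ^ count_list J i"
      using of_nat_mult_power_le[OF r q[of i], of "count_list J i"] by (simp add: power_abs)
  qed
  also have "\<dots> = (\<Prod>i\<in>(UNIV :: 'n set). if i \<in> A then 1 / r else 1) * (2 * r) ^ (\<Sum>i\<in>UNIV. count_list J i)"
    by (simp add: prod.distrib power_sum)
  also have "(\<Sum>i\<in>UNIV. count_list J i) = length J"
    by (intro sum_count_set) auto
  finally show ?thesis .
qed

text \<open>With n for \<open>CARD('n)\<close>, there are n^m words of length m, coefficients up to
  C^m, and differentiated monomials up to a constant times (2r)^m. The radius makes n * C * 2r equal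
  to 1/2, a geometric ratio common to all sets \<open>A\<close>. The induction varies
  \<open>p\<close> over the whole box, since inner derivatives must exist at all nearby
  points.\<close>

lemma power_series_has_mixed_partial:
  fixes a :: "'n::finite list \<Rightarrow> real"
  assumes a: "\<And>J. \<bar>a J\<bar> \<le> C ^ length J" and "C > 0"
  defines "r \<equiv> 1 / (4 * real CARD('n) * C)"
  defines "T A m q \<equiv> \<Sum>J | length J = m. a J * monomial_deriv A J q"
  assumes "distinct js" "\<And>i. \<bar>p $ i\<bar> < r"
  shows "has_mixed_partial js (\<lambda>q. \<Sum>m. T {} m q) (\<Sum>m. T (set js) m p) p"
proof -
  have r: "r > 0" using \<open>C > 0\<close> by (simp add: r_def)
  define K where "K A = (\<Prod>i\<in>(UNIV :: 'n set). if i \<in> A then 1 / r else 1)" for A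
  have T_bound: "\<bar>T A m q\<bar> \<le> K A * (1 / 2) ^ m" if q: "\<And>i. \<bar>q $ i\<bar> < r" for A m q
  proof -
    have "\<bar>T A m q\<bar> \<le> (\<Sum>J | length J = m. \<bar>a J * monomial_deriv A J q\<bar>)"
      unfolding T_def by (rule sum_abs)
    also have "\<dots> \<le> (\<Sum>J\<in>{J :: 'n list. length J = m}. C ^ m * (K A * (2 * r) ^ m))"
    proof (rule sum_mono)
      fix J :: "'n list" assume "J \<in> {J. length J = m}"
      then show "\<bar>a J * monomial_deriv A J q\<bar> \<le> C ^ m * (K A * (2 * r) ^ m)"
        unfolding abs_mult using a[of J] monomial_deriv_bound[OF r less_imp_le[OF q], of A J] \<open>C > 0\<close>
        by (intro mult_mono) (auto simp: K_def)
    qed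
    also have "\<dots> = real (CARD('n) ^ m) * (C ^ m * (K A * (2 * r) ^ m))"
      using card_lists_length_eq[of "UNIV :: 'n set" m] by simp
    also have "\<dots> = K A * (real CARD('n) * C * (2 * r)) ^ m"
      by (simp add: power_mult_distrib)
    also have "real CARD('n) * C * (2 * r) = 1 / 2"
      using \<open>C > 0\<close> by (simp add: r_def)
    finally show ?thesis .
  qed
  have geometric: "summable (\<lambda>m. K A * (1 / 2) ^ m)" for A
    by (intro summable_mult summable_geometric) simp
  show ?thesis
    using assms(5,6)
  proof (induction js arbitrary: p)
    case (Cons j js)
    let ?p = "\<lambda>h. p + h *\<^sub>R axis j 1"
    \<comment> \<open>The parameters \<open>h\<close> for which coordinate \<open>j\<close> of
      \<open>?p h\<close> stays strictly inside the box; the other coordinates do not move.\<close>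
    define S where "S = {- r - p $ j <..< r - p $ j}"
    have box: "\<bar>?p h $ i\<bar> < r" if "h \<in> S" for h i
      using that Cons.prems(2)[of i] by (auto simp: S_def axis_def)
    have "0 \<in> S" using Cons.prems(2)[of j] by (auto simp: S_def abs_less_iff)
    have "((\<lambda>h. \<Sum>m. T (set js) m (?p h)) has_real_derivative (\<Sum>m. T (set (j # js)) m (?p 0))) (at 0)"
    proof (rule has_field_derivative_series'(2))
      show "convex S" by (simp add: S_def convex_real_interval)
      show "((\<lambda>h. T (set js) m (?p h)) has_field_derivative T (set (j # js)) m (?p h)) (at h within S)" for m h
      proof -
        have "((\<lambda>h. a J * monomial_deriv (set js) J (?p h)) has_field_derivative
            a J * monomial_deriv (set (j # js)) J (?p h)) (at h within S)" for J
          using monomial_deriv_has_derivative[of j "set js" J p h] Cons.prems(1)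
          by (intro DERIV_cmult) (simp add: has_field_derivative_at_within)
        then show ?thesis unfolding T_def by (intro DERIV_sum)
      qed
      show "uniformly_convergent_on S (\<lambda>n h. \<Sum>i<n. T (set (j # js)) i (?p h))"
        using T_bound[OF box] geometric by (intro Weierstrass_m_test') auto
      show "summable (\<lambda>m. T (set js) m (?p 0))"
        using T_bound[OF box[OF \<open>0 \<in> S\<close>]]
        by (intro summable_comparison_test'[OF geometric]) auto
      show "0 \<in> interior S" using \<open>0 \<in> S\<close> by (simp add: S_def interior_open)
    qed (rule \<open>0 \<in> S\<close>)
    \<comment> \<open>The box is open, so the induction hypothesis applies throughout a
      neighbourhood of \<open>p\<close>.\<close>
    moreover have "\<forall>\<^sub>F q in nhds p. \<forall>i. \<bar>q $ i\<bar> < r"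
    proof (rule eventually_all_finite)
      fix i
      have "((\<lambda>q. \<bar>q $ i\<bar>) \<longlongrightarrow> \<bar>p $ i\<bar>) (nhds p)"
        by (intro tendsto_intros tendsto_vec_nth filterlim_ident)
      then show "\<forall>\<^sub>F q in nhds p. \<bar>q $ i\<bar> < r"
        using Cons.prems(2)[of i] by (rule order_tendstoD)
    qed
    then have "\<forall>\<^sub>F q in nhds p. has_mixed_partial js (\<lambda>q. \<Sum>m. T {} m q) (\<Sum>m. T (set js) m q) q"
      by eventually_elim (use Cons in auto)
    ultimately show ?case by auto
  qed simp
qed

section \<open>Evaluation at zero\<close>

lemma count_list_distinct: "distinct J \<Longrightarrow> count_list J i = (if i \<in> set J then 1 else 0)"
  by (induction J) auto

lemma distinct_if_count_list_le_1: "(\<And>i. count_list J i \<le> 1) \<Longrightarrow> distinct J"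
proof (induction J)
  case (Cons j J)
  have "count_list J i \<le> 1" for i
    using Cons.prems[of i] by (simp split: if_splits)
  moreover have "count_list J j = 0" using Cons.prems[of j] by simp
  ultimately show ?case using Cons.IH by (simp add: count_list_0_iff)
qed simp

text \<open>A letter occurring c times contributes \<open>c * 0 ^ (c - 1)\<close>: this is 1 for c =
  1, and 0 otherwise, through the coefficient if c = 0 and through the power if c > 1.\<close>

lemma monomial_deriv_UNIV_0:
  fixes J :: "'n::finite list"
  shows "monomial_deriv UNIV J 0 = (if distinct J \<and> set J = (UNIV :: 'n set) then 1 else 0)"
proof (cases "\<forall>i. count_list J i = 1")
  case True
  then have "distinct J" by (simp add: distinct_if_count_list_le_1)
  moreover have "i \<in> set J" for i
    by (rule ccontr) (use True[rule_format, of i] in simp)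
  then have "set J = UNIV" by blast
  ultimately show ?thesis using True by (simp add: monomial_deriv_def)
next
  case False
  then obtain i where i: "count_list J i \<noteq> 1" by blast
  then have "real (count_list J i) * 0 ^ (count_list J i - 1) = (0 :: real)"
    by (cases "count_list J i = 0") auto
  then have "monomial_deriv UNIV J 0 = 0"
    by (auto simp: monomial_deriv_def intro!: exI[of _ i])
  moreover have "\<not> (distinct J \<and> set J = UNIV)" using i count_list_distinct[of J i] by auto
  ultimately show ?thesis by auto
qed

theorem proposition3p1:
  fixes x :: "real \<Rightarrow> real^'d"
    and I :: "'n::{finite,linorder} \<Rightarrow> 'd"
  assumes "C1_path x"
  shows "has_mixed_partial index_list
    (\<lambda>l. signature_kernel (select_path I x) (scale_path l axis_path))
    (signature x (map I index_list)) 0"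
proof -
  obtain w where "controlled_path x w" using assms by (rule C1_path_imp_controlled)
  then interpret controlled_path x w .
  define a where "a J = signature x (map I J) * signature axis_path J" for J :: "'n list"
  \<comment> \<open>One geometric rate per path: \<open>w 1 - w 0\<close> for \<open>x\<close> and
    \<open>CARD('n)\<close> for the axis path.\<close>
  define C where "C = (w 1 - w 0) * real CARD('n)"
  define T where "T A m q = (\<Sum>J | length J = m. a J * monomial_deriv A J q)" for A m q
  \<comment> \<open>Positivity of the rate comes from \<open>w\<close> dominating the identity, even
    for a constant path.\<close>
  have "w 1 - w 0 \<ge> 1" using controlD[OF control_id, of 0 1] by simp
  then have "C > 0" by (simp add: C_def)
  have a: "\<bar>a J\<bar> \<le> C ^ length J" for J
    unfolding a_def C_def abs_mult power_mult_distrib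
    using signature_bound[of "map I J"] axis_path.signature_bound[of J] \<open>w 1 - w 0 \<ge> 1\<close>
    by (intro mult_mono) auto
  have kernel: "signature_kernel (select_path I x) (scale_path l axis_path) = (\<Sum>m. T {} m l)" for l
    by (simp add: signature_kernel_def T_def a_def signature_select_path
        axis_path.signature_scale_path monomial_deriv_empty mult_ac)
  have "has_mixed_partial index_list (\<lambda>l. \<Sum>m. T {} m l) (\<Sum>m. T (set index_list) m 0) 0"
    unfolding T_def using a \<open>C > 0\<close>
    by (intro power_series_has_mixed_partial) (auto simp: index_list_props)
  moreover have "(\<Sum>m. T (set index_list) m 0) = signature x (map I index_list)"
  proof -
    \<comment> \<open>Only the word \<open>index_list\<close> survives, so the whole series reduces
      to its term at its length \<open>CARD('n)\<close>.\<close>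
    have "T UNIV m 0 = (if m = CARD('n) then signature x (map I index_list) else 0)" for m
    proof -
      have "a J * monomial_deriv UNIV J 0 = (if J = index_list then signature x (map I index_list) else 0)" for J
        using signature_axis_path_perm[of J]
        by (auto simp: monomial_deriv_UNIV_0 a_def index_list_props)
      moreover have "finite {J :: 'n list. length J = m}"
        using finite_lists_length_eq[of "UNIV :: 'n set" m] by simp
      ultimately show ?thesis by (auto simp: T_def index_list_props)
    qed
    then show ?thesis
      using sums_single[of "CARD('n)" "\<lambda>_. signature x (map I index_list)"]
      by (simp add: index_list_props sums_iff)
  qed
  ultimately show ?thesis by (simp add: kernel)
qed

end
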